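(* Let $p\in[1,\infty]$, $m\in\mathbb{N}$, $c_1,\dots,c_m\in\mathbb{R}$, and let $\mathscr{T}_\delta$ denote any one of the operators $\mathscr{A}_\delta$, $\mathscr{G}_\delta$, $\mathscr{D}_\delta$ built from $\vec\mu_\delta=(\mu_{\delta,1},\dots,\mu_{\delta,m})$ and $c_1,\dots,c_m$, where each component of $\vec\mu_\delta$ is mean-free, i.e. $\int_{\mathbb{R}^d}\mu_{\delta,k}(z)\,dz=0$ for all $k$. Then $\mathscr{T}_\delta$ is not bounded below on any closed infinite-dimensional subspace of its domain; that is, for every closed infinite-dimensional subspace $X_0$ of the domain of $\mathscr{T}_\delta$ there is no constant $C<\infty$ with $\|u\|\le C\|\mathscr{T}_\delta u\|$ for all $u\in X_0$. In particular, if $\mu_\delta\in L^1(\mathbb{R}^d)$ with $\operatorname{supp}(\mu_\delta)\subseteq\overline{B_\delta(0)}$ is mean-free, then the corresponding operator $\mathcal{D}_\delta$ does not satisfy the Poincaré inequality on $L^p_0(\Omega_\delta)$; that is, there is no constant $C<\infty$ such that $\|u\|_{L^p(\Omega)}\le C\|\mathcal{D}_\delta u\|_{L^p(\Omega)}$ for all $u\in L^p_0(\Omega_\delta)$.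
   Context: $\Omega\subseteq\mathbb{R}^d$ is nonempty, open and bounded and $\delta>0$. The collar is $\Gamma_\delta=\left(\bigcup_{x\in\Omega}\overline{B_\delta(x)}\right)\setminus\Omega$, $\Omega_\delta=\Omega\cup\Gamma_\delta$, and $L^p_0(\Omega_\delta)=\{u\in L^p(\Omega_\delta):u=0\text{ a.e. in }\Gamma_\delta\}$. For a real-valued kernel $\mu_\delta\in L^1(\mathbb{R}^d)$ supported in $\overline{B_\delta(0)}$, the nonlocal derivative $\mathcal{D}_\delta:L^p(\Omega_\delta)\to L^p(\Omega)$ is $\mathcal{D}_\delta u(x)=\int_{\mathbb{R}^d}[u(x+z)-u(x)]\mu_\delta(z)\,dz$ for $x\in\Omega$, and the extended nonlocal derivative $\overline{\mathcal{D}_\delta}:L^p(\Omega_\delta)\to L^p(\Omega_\delta)$ is $\overline{\mathcal{D}_\delta}u=\mathcal{D}_\delta u$ on $\Omega$ and $\overline{\mathcal{D}_\delta}u=0$ on $\Gamma_\delta$. Let $\vec\mu_\delta=(\mu_{\delta,1},\dots,\mu_{\delta,m})\in L^1(\mathbb{R}^d)^m$ with $\operatorname{supp}\vec\mu_\delta\subseteq\overline{B_\delta(0)}$, and let $\overline{\mathcal{D}_{\delta,k}}$ be the extended nonlocal derivative with kernel $\mu_{\delta,k}$. Then $\mathscr{A}_\delta:L^p(\Omega_\delta)\to L^p(\Omega_\delta)$, $\mathscr{A}_\delta u=\sum_{k=1}^mc_k\overline{\mathcal{D}_{\delta,k}}u$; $\mathscr{G}_\delta:L^p(\Omega_\delta)\to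 L^p(\Omega_\delta)^m$, $\mathscr{G}_\delta u=(c_1\overline{\mathcal{D}_{\delta,1}}u,\dots,c_m\overline{\mathcal{D}_{\delta,m}}u)$; $\mathscr{D}_\delta:L^p(\Omega_\delta)^m\to L^p(\Omega_\delta)$, $\mathscr{D}_\delta(u_1,\dots,u_m)=\sum_{k=1}^mc_k\overline{\mathcal{D}_{\delta,k}}u_k$. *)

theory Defs
  imports
    "HOL-Analysis.Analysis"
    "HOL-Probability.Essential_Supremum"
    "HOL-Library.Function_Algebras"
begin

text \<open>
  Elements of an \<open>L\<^sup>p\<close> space are represented by Lebesgue measurable functions;
  functions that agree almost everywhere are at seminorm distance \<open>0\<close> and are identified in
  this sense throughout. Functions form a real vector space pointwise, so that the library
  notions \<^const>\<open>subspace\<close> and \<^const>\<open>span\<close> apply to them and, componentwise, to vectors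
  of functions.
\<close>

instantiation "fun" :: (type, real_vector) real_vector
begin

definition scaleR_fun :: "real \<Rightarrow> ('a \<Rightarrow> 'b) \<Rightarrow> 'a \<Rightarrow> 'b" where
  "scaleR_fun r f = (\<lambda>x. r *\<^sub>R f x)"

instance
  by standard (simp_all add: scaleR_fun_def fun_eq_iff scaleR_add_right scaleR_add_left)

end

text \<open>The value is only meaningful for functions that are measurable on \<open>S\<close>.\<close>

definition Lp_norm :: "ennreal \<Rightarrow> 'a::euclidean_space set \<Rightarrow> ('a \<Rightarrow> real) \<Rightarrow> ennreal" where
  "Lp_norm p S u =
     (if p = \<infinity> then esssup (lebesgue_on S) (\<lambda>x. ennreal \<bar>u x\<bar>)
      else let I = (\<integral>\<^sup>+ x. ennreal (\<bar>u x\<bar> powr enn2real p) \<partial>lebesgue_on S)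
           in if I = \<infinity> then \<infinity> else ennreal (enn2real I powr (1 / enn2real p)))"

definition Lp_space :: "ennreal \<Rightarrow> 'a::euclidean_space set \<Rightarrow> ('a \<Rightarrow> real) set" where
  "Lp_space p S = {u \<in> borel_measurable (lebesgue_on S). Lp_norm p S u < \<infinity>}"

text \<open>
  The \<open>m\<close>-fold product \<open>L\<^sup>p(S)\<^sup>m\<close> with \<open>m = CARD('m)\<close>. All the usual product norms are
  equivalent; we use the sum of the norms of the components.
\<close>

definition Lp_vec_norm ::
  "ennreal \<Rightarrow> 'a::euclidean_space set \<Rightarrow> ('a \<Rightarrow> real) ^ 'm::finite \<Rightarrow> ennreal" where
  "Lp_vec_norm p S u = (\<Sum>k\<in>UNIV. Lp_norm p S (u $ k))"

definition Lp_vec_space ::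
  "ennreal \<Rightarrow> 'a::euclidean_space set \<Rightarrow> (('a \<Rightarrow> real) ^ 'm::finite) set" where
  "Lp_vec_space p S = {u. \<forall>k. u $ k \<in> Lp_space p S}"

text \<open>
  In the next three definitions \<open>N\<close> and \<open>N'\<close> are seminorms; \<open>V\<close> is the space of the vectors
  of finite seminorm. Passing to the quotient by the vectors of seminorm \<open>0\<close>, they are the usual
  notions for normed spaces. In particular a closed subspace contains with a function all
  functions that agree with it almost everywhere, and infinite dimension means that no finite set
  spans up to vectors of seminorm \<open>0\<close>.
\<close>

definition closed_subspace ::
  "('v::real_vector \<Rightarrow> ennreal) \<Rightarrow> 'v set \<Rightarrow> 'v set \<Rightarrow> bool" where
  "closed_subspace N V X \<longleftrightarrow> subspace X \<and> X \<subseteq> V \<and>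
     (\<forall>s u. (\<forall>n::nat. s n \<in> X) \<longrightarrow> u \<in> V \<longrightarrow> (\<lambda>n. N (s n - u)) \<longlonglongrightarrow> 0 \<longrightarrow> u \<in> X)"

definition infinite_dimensional :: "('v::real_vector \<Rightarrow> ennreal) \<Rightarrow> 'v set \<Rightarrow> bool" where
  "infinite_dimensional N X \<longleftrightarrow>
     \<not> (\<exists>B. finite B \<and> B \<subseteq> X \<and> (\<forall>u\<in>X. \<exists>v\<in>span B. N (u - v) = 0))"

definition bounded_below_on ::
  "('v \<Rightarrow> ennreal) \<Rightarrow> ('w \<Rightarrow> ennreal) \<Rightarrow> ('v \<Rightarrow> 'w) \<Rightarrow> 'v set \<Rightarrow> bool" where
  "bounded_below_on N N' T X \<longleftrightarrow> (\<exists>C::real. \<forall>u\<in>X. N u \<le> ennreal C * N' (T u))"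

definition collar :: "'a::euclidean_space set \<Rightarrow> real \<Rightarrow> 'a set" where
  "collar \<Omega> \<delta> = (\<Union>x\<in>\<Omega>. cball x \<delta>) - \<Omega>"

definition enlarged :: "'a::euclidean_space set \<Rightarrow> real \<Rightarrow> 'a set" where
  "enlarged \<Omega> \<delta> = \<Omega> \<union> collar \<Omega> \<delta>"

definition Lp0_space :: "ennreal \<Rightarrow> 'a::euclidean_space set \<Rightarrow> real \<Rightarrow> ('a \<Rightarrow> real) set" where
  "Lp0_space p \<Omega> \<delta> =
     {u \<in> Lp_space p (enlarged \<Omega> \<delta>). AE x in lebesgue_on (collar \<Omega> \<delta>). u x = 0}"

text \<open>The support of a class of functions modulo equality almost everywhere.\<close>

definition ess_support :: "('a::euclidean_space \<Rightarrow> real) \<Rightarrow> 'a set" where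
  "ess_support f = - \<Union> {U. open U \<and> (AE x in lebesgue. x \<in> U \<longrightarrow> f x = 0)}"

definition mean_free :: "('a::euclidean_space \<Rightarrow> real) \<Rightarrow> bool" where
  "mean_free \<mu> \<longleftrightarrow> (\<integral>z. \<mu> z \<partial>lebesgue) = 0"

text \<open>
  For \<open>x \<in> \<Omega>\<close> and \<open>\<mu>\<close> supported in \<open>cball 0 \<delta>\<close> the integrand vanishes for almost all \<open>z\<close>
  with \<open>x + z\<close> outside the enlarged domain. Since \<^term>\<open>lebesgue\<close> is complete, the (arbitrary)
  values of \<open>u\<close> there do not matter.
\<close>

definition nonlocal_deriv ::
  "('a::euclidean_space \<Rightarrow> real) \<Rightarrow> ('a \<Rightarrow> real) \<Rightarrow> 'a \<Rightarrow> real" where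
  "nonlocal_deriv \<mu> u x = (\<integral>z. (u (x + z) - u x) * \<mu> z \<partial>lebesgue)"

definition ext_nonlocal_deriv ::
  "'a::euclidean_space set \<Rightarrow> ('a \<Rightarrow> real) \<Rightarrow> ('a \<Rightarrow> real) \<Rightarrow> 'a \<Rightarrow> real" where
  "ext_nonlocal_deriv \<Omega> \<mu> u x = (if x \<in> \<Omega> then nonlocal_deriv \<mu> u x else 0)"

definition op_A ::
  "'a::euclidean_space set \<Rightarrow> ('a \<Rightarrow> real) ^ 'm::finite \<Rightarrow> real ^ 'm \<Rightarrow>
   ('a \<Rightarrow> real) \<Rightarrow> ('a \<Rightarrow> real)" where
  "op_A \<Omega> \<mu> c u = (\<Sum>k\<in>UNIV. (c $ k) *\<^sub>R ext_nonlocal_deriv \<Omega> (\<mu> $ k) u)"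

definition op_G ::
  "'a::euclidean_space set \<Rightarrow> ('a \<Rightarrow> real) ^ 'm::finite \<Rightarrow> real ^ 'm \<Rightarrow>
   ('a \<Rightarrow> real) \<Rightarrow> ('a \<Rightarrow> real) ^ 'm" where
  "op_G \<Omega> \<mu> c u = (\<chi> k. (c $ k) *\<^sub>R ext_nonlocal_deriv \<Omega> (\<mu> $ k) u)"

definition op_D ::
  "'a::euclidean_space set \<Rightarrow> ('a \<Rightarrow> real) ^ 'm::finite \<Rightarrow> real ^ 'm \<Rightarrow>
   ('a \<Rightarrow> real) ^ 'm \<Rightarrow> ('a \<Rightarrow> real)" where
  "op_D \<Omega> \<mu> c u = (\<Sum>k\<in>UNIV. (c $ k) *\<^sub>R ext_nonlocal_deriv \<Omega> (\<mu> $ k) (u $ k))"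

end

theory Submission
  imports Defs
begin

text \<open>
  Since a mean-free kernel \<open>\<mu>\<close> annihilates constants, the nonlocal derivative is on \<open>\<Omega>\<close> the
  correlation \<open>x \<mapsto> \<integral> u(y) \<mu>(y - x) dy\<close> (lemma \<open>nonlocal_deriv_eq_convolution\<close>). On bounded domains
  such an operator is compact for every \<open>p \<in> [1, \<infinity>]\<close>, and a compact operator cannot be bounded
  below on an infinite-dimensional space.

  Compactness enters as approximation by operators of finite rank, in a form that speaks only of
  the null spaces of those operators: for every \<open>\<epsilon> > 0\<close> there are finitely many linear functionals on
  the domain such that \<open>\<parallel>T u\<parallel> \<le> \<epsilon> \<parallel>u\<parallel>\<close> whenever all of them vanish at \<open>u\<close>. On an
  infinite-dimensional space some \<open>u\<close> with \<open>\<parallel>u\<parallel> \<noteq> 0\<close> is annihilated by all the functionals, so no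
  inequality \<open>\<parallel>u\<parallel> \<le> C \<parallel>T u\<parallel>\<close> survives the choice of \<open>\<epsilon>\<close> with \<open>C \<epsilon> < 1\<close>
  (\<open>not_bounded_below_if_finite_rank_approximable\<close>).

  For the nonlocal derivative the functionals are \<open>u \<mapsto> \<integral> u(y) h(y - c) dy\<close>, where \<open>h\<close> is a
  continuous function close to \<open>\<mu>\<close> in \<open>L\<^sup>1\<close> and \<open>c\<close> ranges over the finitely many values of a map \<open>q\<close>
  that moves the points of \<open>\<Omega>\<close> only a little. If they all vanish at \<open>u\<close>, then \<open>\<mu>(y - x)\<close> may be
  replaced under the integral by \<open>\<mu>(y - x) - h(y - q x)\<close>. The integrals of the absolute value of this
  kernel over \<open>x\<close> and over \<open>y\<close> are both at most \<open>\<epsilon>\<close> (\<open>kernel_discretisation\<close>), so Schur's test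
  (\<open>Schur_test\<close>) bounds the operator by \<open>\<epsilon>\<close> on all \<open>L\<^sup>p\<close> at once.

  The three operators built from several kernels inherit the approximation property from their
  components. The failing Poincare inequality is the case of the domain
  \<open>L\<^sup>p\<^sub>0\<close>, which is infinite-dimensional because \<open>\<Omega>\<close> contains infinitely many disjoint open sets.
\<close>

section \<open>Operators approximable by finite rank\<close>

definition linear_functional_on :: "'v::real_vector set \<Rightarrow> ('v \<Rightarrow> real) \<Rightarrow> bool" where
  "linear_functional_on V l \<longleftrightarrow>
     (\<forall>u\<in>V. \<forall>v\<in>V. l (u + v) = l u + l v) \<and> (\<forall>u\<in>V. \<forall>a. l (a *\<^sub>R u) = a * l u)"

text \<open>
  An operator of the form \<open>u \<mapsto> \<Sum>j. l j u *\<^sub>R g j\<close> within operator norm \<open>\<epsilon>\<close> of \<open>T\<close> yields the condition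
  with the set of the functionals \<open>l j\<close>. The set \<open>L\<close> matters only through its common kernel, which
  is a subspace of finite codimension on which \<open>T\<close> is small.
\<close>

definition finite_rank_approximable ::
  "'v::real_vector set \<Rightarrow> ('v \<Rightarrow> ennreal) \<Rightarrow> ('w \<Rightarrow> ennreal) \<Rightarrow> ('v \<Rightarrow> 'w) \<Rightarrow> bool" where
  "finite_rank_approximable V N N' T \<longleftrightarrow>
     (\<forall>\<epsilon>>0. \<exists>L. finite L \<and> (\<forall>l\<in>L. linear_functional_on V l) \<and>
        (\<forall>u\<in>V. (\<forall>l\<in>L. l u = 0) \<longrightarrow> N' (T u) \<le> ennreal \<epsilon> * N u))"

lemma linear_functional_on_diff:
  assumes "linear_functional_on V l" "subspace V" "u \<in> V" "v \<in> V"
  shows "l (u - v) = l u - l v"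
proof -
  have "l (u - v) = l (u + (-1) *\<^sub>R v)" by simp
  also have "\<dots> = l u + l ((-1) *\<^sub>R v)"
    using assms subspace_scale[OF assms(2,4)] unfolding linear_functional_on_def by blast
  also have "l ((-1) *\<^sub>R v) = -1 * l v"
    using assms unfolding linear_functional_on_def by blast
  finally show ?thesis by simp
qed

text \<open>
  Each further functional either vanishes on the common kernel of the previous ones, or one vector
  of that kernel on which it does not vanish is added to \<open>B\<close>.
\<close>

lemma finite_codimension_of_common_kernel:
  fixes X :: "'v::real_vector set"
  assumes X: "subspace X" and "finite L" and "\<forall>l\<in>L. linear_functional_on X l"
  shows "\<exists>B. finite B \<and> B \<subseteq> X \<and> (\<forall>u\<in>X. \<exists>v\<in>span B. \<forall>l\<in>L. l (u - v) = 0)"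
  using assms(2,3)
proof (induction L rule: finite_induct)
  case empty
  then show ?case by (intro exI[of _ "{}"]) auto
next
  case (insert l L)
  then obtain B where B: "finite B" "B \<subseteq> X"
    and BL: "\<And>u. u \<in> X \<Longrightarrow> \<exists>v\<in>span B. \<forall>l\<in>L. l (u - v) = 0" by auto
  have spanX: "span C \<subseteq> X" if "C \<subseteq> X" for C
    using that X by (simp add: span_minimal)
  show ?case
  proof (cases "\<exists>w\<in>X. (\<forall>l\<in>L. l w = 0) \<and> l w \<noteq> 0")
    case False
    have "\<exists>v\<in>span B. \<forall>l\<in>insert l L. l (u - v) = 0" if uX: "u \<in> X" for u
    proof -
      obtain v where v: "v \<in> span B" "\<forall>l\<in>L. l (u - v) = 0" using BL[OF uX] by blast
      have "u - v \<in> X" using v spanX[OF B(2)] uX X subspace_diff by blast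
      then have "l (u - v) = 0" using False v(2) by blast
      with v show ?thesis by auto
    qed
    with B show ?thesis by blast
  next
    case True
    then obtain w where w: "w \<in> X" "\<forall>l\<in>L. l w = 0" "l w \<noteq> 0" by blast
    have "\<exists>v\<in>span (insert w B). \<forall>l\<in>insert l L. l (u - v) = 0" if uX: "u \<in> X" for u
    proof -
      obtain v where v: "v \<in> span B" "\<forall>l\<in>L. l (u - v) = 0" using BL[OF uX] by blast
      have uv: "u - v \<in> X" using v spanX[OF B(2)] uX X subspace_diff by blast
      define a where "a = l (u - v) / l w"
      have aw: "a *\<^sub>R w \<in> X" using X w(1) subspace_scale by blast
      have eq: "u - (v + a *\<^sub>R w) = (u - v) - a *\<^sub>R w" by simp
      have "k (u - (v + a *\<^sub>R w)) = 0" if kL: "k \<in> insert l L" for k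
      proof -
        have k: "linear_functional_on X k" using kL insert.prems by blast
        have "k (a *\<^sub>R w) = a * k w" using k w(1) unfolding linear_functional_on_def by blast
        then have "k (u - (v + a *\<^sub>R w)) = k (u - v) - a * k w"
          unfolding eq using linear_functional_on_diff[OF k X uv aw] by simp
        then show ?thesis using kL v(2) w(2,3) by (cases "k = l") (auto simp: a_def)
      qed
      moreover have "v + a *\<^sub>R w \<in> span (insert w B)"
        using span_mono[OF subset_insertI[of B w]] v(1)
        by (intro span_add span_scale) (auto intro: span_base)
      ultimately show ?thesis by blast
    qed
    with B w(1) show ?thesis by (intro exI[of _ "insert w B"]) auto
  qed
qed

text \<open>
  If \<open>T\<close> were bounded below with constant \<open>C\<close>, take the functionals for an \<open>\<epsilon>\<close> with \<open>\<bar>C\<bar> \<epsilon> \<le> 1/2\<close>.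
  On their common kernel \<open>N u \<le> C N' (T u) \<le> N u / 2\<close>, so \<open>N\<close> vanishes there. The common kernel has
  finite codimension in \<open>X\<close>, so \<open>X\<close> would be finite-dimensional up to vectors of seminorm \<open>0\<close>.
\<close>

theorem not_bounded_below_if_finite_rank_approximable:
  assumes T: "finite_rank_approximable V N N' T"
    and X: "subspace X" "X \<subseteq> V" and fin: "\<And>u. u \<in> V \<Longrightarrow> N u < \<infinity>"
    and inf: "infinite_dimensional N X"
  shows "\<not> bounded_below_on N N' T X"
proof
  assume "bounded_below_on N N' T X"
  then obtain C where C: "\<And>u. u \<in> X \<Longrightarrow> N u \<le> ennreal C * N' (T u)"
    unfolding bounded_below_on_def by blast
  define \<epsilon> where "\<epsilon> = 1 / (2 * (\<bar>C\<bar> + 1))"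
  have "\<epsilon> > 0" by (simp add: \<epsilon>_def add_pos_pos)
  then obtain L where L: "finite L" "\<forall>l\<in>L. linear_functional_on V l"
    "\<And>u. u \<in> V \<Longrightarrow> \<forall>l\<in>L. l u = 0 \<Longrightarrow> N' (T u) \<le> ennreal \<epsilon> * N u"
    using T unfolding finite_rank_approximable_def by meson
  have "\<forall>l\<in>L. linear_functional_on X l"
    using L(2) X(2) unfolding linear_functional_on_def by blast
  then obtain B where B: "finite B" "B \<subseteq> X"
    "\<And>u. u \<in> X \<Longrightarrow> \<exists>v\<in>span B. \<forall>l\<in>L. l (u - v) = 0"
    using finite_codimension_of_common_kernel[OF X(1) L(1)] by blast
  have null: "N w = 0" if w: "w \<in> X" "\<forall>l\<in>L. l w = 0" for w
  proof -
    obtain n where n: "N w = ennreal n" "n \<ge> 0"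
      using fin[of w] w(1) X(2) by (cases "N w") auto
    have "N w \<le> ennreal \<bar>C\<bar> * (ennreal \<epsilon> * N w)"
      using C[OF w(1)] L(3)[of w] w X(2)
      by (meson abs_ge_self ennreal_leI mult_mono order_trans subsetD zero_le)
    then have "n \<le> \<bar>C\<bar> * \<epsilon> * n"
      using n \<open>\<epsilon> > 0\<close> by (simp flip: ennreal_mult add: mult.assoc)
    also have "\<dots> \<le> (1/2) * n"
      using n(2) by (intro mult_right_mono) (auto simp: \<epsilon>_def field_simps)
    finally show ?thesis using n by simp
  qed
  have "\<exists>v\<in>span B. N (u - v) = 0" if uX: "u \<in> X" for u
  proof -
    obtain v where v: "v \<in> span B" "\<forall>l\<in>L. l (u - v) = 0" using B(3)[OF uX] by blast
    have "span B \<subseteq> X" using B(2) X(1) by (simp add: span_minimal)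
    then have "u - v \<in> X" using v uX X(1) subspace_diff by blast
    with null v show ?thesis by blast
  qed
  with B(1,2) inf show False unfolding infinite_dimensional_def by blast
qed

text \<open>
  This gives the approximation property of any operator that is controlled by finitely many
  approximable ones; linear combinations and tuples of operators are both of this kind. The
  functionals for the summands are simply collected.
\<close>

lemma finite_rank_approximable_sum_bound:
  assumes K: "finite K"
    and T: "\<And>k. k \<in> K \<Longrightarrow> finite_rank_approximable V N N' (T k)"
    and S: "\<And>u. u \<in> V \<Longrightarrow> N'' (S u) \<le> ennreal C * (\<Sum>k\<in>K. N' (T k u))"
  shows "finite_rank_approximable V N N'' S"
  unfolding finite_rank_approximable_def
proof (intro allI impI)
  fix \<epsilon> :: real assume "\<epsilon> > 0"
  define \<eta> where "\<eta> = \<epsilon> / ((\<bar>C\<bar> + 1) * (real (card K) + 1))"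
  have \<eta>: "\<eta> > 0" using \<open>\<epsilon> > 0\<close> by (simp add: \<eta>_def add_pos_pos add_nonneg_pos)
  have C\<eta>: "\<bar>C\<bar> * (real (card K) * \<eta>) \<le> \<epsilon>"
  proof -
    have "\<bar>C\<bar> * (real (card K) * \<eta>) \<le> (\<bar>C\<bar> + 1) * ((real (card K) + 1) * \<eta>)"
      using \<eta> by (intro mult_mono) auto
    also have "\<dots> = \<epsilon>" by (simp add: \<eta>_def add_nonneg_eq_0_iff)
    finally show ?thesis .
  qed
  have "\<forall>k\<in>K. \<exists>L. finite L \<and> (\<forall>l\<in>L. linear_functional_on V l) \<and>
        (\<forall>u\<in>V. (\<forall>l\<in>L. l u = 0) \<longrightarrow> N' (T k u) \<le> ennreal \<eta> * N u)"
    using T \<eta> unfolding finite_rank_approximable_def by blast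
  then obtain L where L: "\<And>k. k \<in> K \<Longrightarrow> finite (L k)"
    "\<And>k l. k \<in> K \<Longrightarrow> l \<in> L k \<Longrightarrow> linear_functional_on V l"
    "\<And>k u. k \<in> K \<Longrightarrow> u \<in> V \<Longrightarrow> \<forall>l\<in>L k. l u = 0 \<Longrightarrow> N' (T k u) \<le> ennreal \<eta> * N u"
    by metis
  have "N'' (S u) \<le> ennreal \<epsilon> * N u" if u: "u \<in> V" "\<forall>l\<in>(\<Union>k\<in>K. L k). l u = 0" for u
  proof -
    have "N'' (S u) \<le> ennreal C * (\<Sum>k\<in>K. N' (T k u))" by (rule S[OF u(1)])
    also have "\<dots> \<le> ennreal \<bar>C\<bar> * (\<Sum>k\<in>K. ennreal \<eta> * N u)"
      using L(3) u by (intro mult_mono sum_mono ennreal_leI) auto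
    also have "\<dots> = ennreal (\<bar>C\<bar> * (real (card K) * \<eta>)) * N u"
      using \<eta> by (simp add: ennreal_mult ennreal_of_nat_eq_real_of_nat mult.assoc)
    also have "\<dots> \<le> ennreal \<epsilon> * N u"
      using C\<eta> by (intro mult_right_mono ennreal_leI) auto
    finally show ?thesis .
  qed
  then show "\<exists>L. finite L \<and> (\<forall>l\<in>L. linear_functional_on V l) \<and>
        (\<forall>u\<in>V. (\<forall>l\<in>L. l u = 0) \<longrightarrow> N'' (S u) \<le> ennreal \<epsilon> * N u)"
    using K L(1,2) by (intro exI[of _ "\<Union>k\<in>K. L k"]) auto
qed

lemma finite_rank_approximable_compose:
  assumes T: "finite_rank_approximable V N N' T"
    and P: "\<And>u. u \<in> V' \<Longrightarrow> P u \<in> V" "\<And>u v. P (u + v) = P u + P v"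
      "\<And>a u. P (a *\<^sub>R u) = a *\<^sub>R P u" "\<And>u. u \<in> V' \<Longrightarrow> N (P u) \<le> M u"
  shows "finite_rank_approximable V' M N' (\<lambda>u. T (P u))"
  unfolding finite_rank_approximable_def
proof (intro allI impI)
  fix \<epsilon> :: real assume "\<epsilon> > 0"
  then obtain L where L: "finite L" "\<forall>l\<in>L. linear_functional_on V l"
    "\<And>u. u \<in> V \<Longrightarrow> \<forall>l\<in>L. l u = 0 \<Longrightarrow> N' (T u) \<le> ennreal \<epsilon> * N u"
    using T unfolding finite_rank_approximable_def by meson
  have "N' (T (P u)) \<le> ennreal \<epsilon> * M u" if "u \<in> V'" "\<forall>l\<in>(\<lambda>l. l \<circ> P) ` L. l u = 0" for u
  proof -
    have "N' (T (P u)) \<le> ennreal \<epsilon> * N (P u)" using L(3)[of "P u"] that P(1) by auto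
    also have "\<dots> \<le> ennreal \<epsilon> * M u" using P(4) that by (intro mult_left_mono) auto
    finally show ?thesis .
  qed
  then show "\<exists>L. finite L \<and> (\<forall>l\<in>L. linear_functional_on V' l) \<and>
        (\<forall>u\<in>V'. (\<forall>l\<in>L. l u = 0) \<longrightarrow> N' (T (P u)) \<le> ennreal \<epsilon> * M u)"
    using L(1,2) P
    by (intro exI[of _ "(\<lambda>l. l \<circ> P) ` L"]) (auto simp: linear_functional_on_def)
qed

section \<open>Norms and integral inequalities\<close>

text \<open>
  Together with \<open>Lp_norm_le_iff\<close> for \<open>p < \<infinity>\<close>, this turns norm estimates into estimates almost
  everywhere or of an integral, with no roots and no infinite values left.
\<close>

lemma Lp_norm_top_le_iff:
  assumes f: "f \<in> borel_measurable (lebesgue_on S)" and a: "0 \<le> a"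
  shows "Lp_norm \<infinity> S f \<le> ennreal a \<longleftrightarrow> (AE x in lebesgue_on S. \<bar>f x\<bar> \<le> a)"
proof
  assume "Lp_norm \<infinity> S f \<le> ennreal a"
  moreover have "AE x in lebesgue_on S. ennreal \<bar>f x\<bar> \<le> Lp_norm \<infinity> S f"
    by (simp add: Lp_norm_def esssup_AE)
  ultimately have "AE x in lebesgue_on S. ennreal \<bar>f x\<bar> \<le> ennreal a"
    by (auto elim!: eventually_mono)
  then show "AE x in lebesgue_on S. \<bar>f x\<bar> \<le> a" using a by simp
next
  assume "AE x in lebesgue_on S. \<bar>f x\<bar> \<le> a"
  then show "Lp_norm \<infinity> S f \<le> ennreal a"
    using f a by (auto simp: Lp_norm_def intro!: esssup_I)
qed

lemma enn2real_ge_one: "1 \<le> enn2real p" if "1 \<le> p" "p \<noteq> \<infinity>" for p :: ennreal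
  using that by (cases p) auto

lemma Lp_norm_le_iff:
  assumes p: "1 \<le> p" "p \<noteq> \<infinity>" and a: "0 \<le> a"
  shows "Lp_norm p S f \<le> ennreal a \<longleftrightarrow>
    (\<integral>\<^sup>+ x. ennreal (\<bar>f x\<bar> powr enn2real p) \<partial>lebesgue_on S) \<le> ennreal (a powr enn2real p)"
proof -
  define r where "r = enn2real p"
  have r: "1 \<le> r" using enn2real_ge_one[OF p] by (simp add: r_def)
  define I where "I = (\<integral>\<^sup>+ x. ennreal (\<bar>f x\<bar> powr r) \<partial>lebesgue_on S)"
  show ?thesis
  proof (cases "I = \<infinity>")
    case True
    then show ?thesis using p by (auto simp: Lp_norm_def I_def r_def top_unique)
  next
    case False
    then obtain i where i: "I = ennreal i" "0 \<le> i" by (cases I) auto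
    have "Lp_norm p S f = ennreal (i powr (1 / r))"
      using p i False by (simp add: Lp_norm_def I_def r_def Let_def)
    moreover have "i powr (1 / r) \<le> a \<longleftrightarrow> i \<le> a powr r"
    proof
      assume "i powr (1 / r) \<le> a"
      then have "(i powr (1 / r)) powr r \<le> a powr r" using r by (intro powr_mono2) auto
      then show "i \<le> a powr r" using r i by (simp add: powr_powr)
    next
      assume "i \<le> a powr r"
      then have "i powr (1 / r) \<le> (a powr r) powr (1 / r)" using r i by (intro powr_mono2) auto
      then show "i powr (1 / r) \<le> a" using r a by (simp add: powr_powr)
    qed
    ultimately show ?thesis using i a by (simp add: I_def[symmetric] r_def[symmetric])
  qed
qed

lemma Lp_norm_cong_AE:
  assumes "f \<in> borel_measurable (lebesgue_on S)" "g \<in> borel_measurable (lebesgue_on S)"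
    and "AE x in lebesgue_on S. f x = g x"
  shows "Lp_norm p S f = Lp_norm p S g"
proof (cases "p = \<infinity>")
  case True
  then show ?thesis using assms
    by (auto simp: Lp_norm_def intro!: esssup_AE_cong elim!: eventually_mono)
next
  case False
  have "(\<integral>\<^sup>+ x. ennreal (\<bar>f x\<bar> powr enn2real p) \<partial>lebesgue_on S) =
        (\<integral>\<^sup>+ x. ennreal (\<bar>g x\<bar> powr enn2real p) \<partial>lebesgue_on S)"
    using assms(3) by (intro nn_integral_cong_AE) (auto elim!: eventually_mono)
  with False show ?thesis by (simp add: Lp_norm_def)
qed

lemma AE_lebesgue_on_iff_lborel:
  assumes "S \<in> sets lebesgue"
  shows "(AE x in lebesgue_on S. P x) \<longleftrightarrow> (AE x in lborel. x \<in> S \<longrightarrow> P x)"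
  using assms by (simp add: AE_restrict_space_iff AE_completion_iff)

lemma Lp_norm_extend_zero:
  assumes "S \<in> sets lebesgue" "S' \<in> sets lebesgue" "S \<subseteq> S'" "1 \<le> p"
    and f: "f \<in> borel_measurable (lebesgue_on S')" and z: "AE x in lebesgue_on (S' - S). f x = 0"
  shows "Lp_norm p S' f = Lp_norm p S f"
proof -
  have fS: "f \<in> borel_measurable (lebesgue_on S)"
    using f assms(3) by (rule measurable_restrict_mono)
  have z': "AE x in lborel. x \<in> S' - S \<longrightarrow> f x = 0"
    using z assms(1,2) by (subst (asm) AE_lebesgue_on_iff_lborel) auto
  have "Lp_norm p S' f \<le> ennreal a \<longleftrightarrow> Lp_norm p S f \<le> ennreal a" if a: "0 \<le> a" for a
  proof (cases "p = \<infinity>")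
    case True
    have "(AE x in lborel. x \<in> S' \<longrightarrow> \<bar>f x\<bar> \<le> a) \<longleftrightarrow> (AE x in lborel. x \<in> S \<longrightarrow> \<bar>f x\<bar> \<le> a)"
    proof
      assume "AE x in lborel. x \<in> S' \<longrightarrow> \<bar>f x\<bar> \<le> a"
      then show "AE x in lborel. x \<in> S \<longrightarrow> \<bar>f x\<bar> \<le> a"
        by eventually_elim (use assms(3) in auto)
    next
      assume "AE x in lborel. x \<in> S \<longrightarrow> \<bar>f x\<bar> \<le> a"
      with z' show "AE x in lborel. x \<in> S' \<longrightarrow> \<bar>f x\<bar> \<le> a"
        by eventually_elim (use a in auto)
    qed
    then show ?thesis unfolding True
      by (subst (1 2) Lp_norm_top_le_iff) (auto simp: f fS a AE_lebesgue_on_iff_lborel assms(1,2))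
  next
    case False
    have "(\<integral>\<^sup>+ x. ennreal (\<bar>f x\<bar> powr enn2real p) \<partial>lebesgue_on S') =
          (\<integral>\<^sup>+ x. ennreal (\<bar>f x\<bar> powr enn2real p) * indicator S' x \<partial>lborel)"
      using assms(2) by (simp add: nn_integral_restrict_space nn_integral_completion)
    also have "\<dots> = (\<integral>\<^sup>+ x. ennreal (\<bar>f x\<bar> powr enn2real p) * indicator S x \<partial>lborel)"
      using z' assms(3) by (intro nn_integral_cong_AE) (auto elim!: eventually_mono simp: indicator_def)
    also have "\<dots> = (\<integral>\<^sup>+ x. ennreal (\<bar>f x\<bar> powr enn2real p) \<partial>lebesgue_on S)"
      using assms(1) by (simp add: nn_integral_restrict_space nn_integral_completion)
    finally show ?thesis unfolding Lp_norm_le_iff[OF assms(4) False a] by simp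
  qed
  note * = this
  show ?thesis
  proof (rule antisym)
    show "Lp_norm p S' f \<le> Lp_norm p S f"
      using *[of "enn2real (Lp_norm p S f)"] by (cases "Lp_norm p S f") auto
    show "Lp_norm p S f \<le> Lp_norm p S' f"
      using *[of "enn2real (Lp_norm p S' f)"] by (cases "Lp_norm p S' f") auto
  qed
qed

lemma Lp_norm_eq_0_iff:
  assumes f: "f \<in> borel_measurable (lebesgue_on S)" and p: "1 \<le> p"
  shows "Lp_norm p S f = 0 \<longleftrightarrow> (AE x in lebesgue_on S. f x = 0)"
proof (cases "p = \<infinity>")
  case True
  show ?thesis using Lp_norm_top_le_iff[OF f, of 0] by (simp add: True)
next
  case False
  have "(\<integral>\<^sup>+ x. ennreal (\<bar>f x\<bar> powr enn2real p) \<partial>lebesgue_on S) = 0 \<longleftrightarrow>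
     (AE x in lebesgue_on S. ennreal (\<bar>f x\<bar> powr enn2real p) = 0)"
    using f by (intro nn_integral_0_iff_AE) auto
  then show ?thesis using Lp_norm_le_iff[OF p False, of 0 S f] by simp
qed

text \<open>
  The convex function \<open>a \<mapsto> a\<^sup>r\<close> lies above its tangent at \<open>s\<close>; this is Young's inequality for
  the product of \<open>a\<close> and \<open>s\<^sup>r\<^sup>-\<^sup>1\<close>.
\<close>

lemma tangent_line_powr:
  fixes r a s :: real
  assumes "1 \<le> r" "0 \<le> a" "0 < s"
  shows "r * s powr (r - 1) * a \<le> a powr r + (r - 1) * s powr r"
proof (cases "a = 0")
  case True
  then show ?thesis using assms by simp
next
  case False
  have "(a powr r) powr (1/r) * (s powr r) powr (1 - 1/r) \<le> 1/r * a powr r + (1 - 1/r) * s powr r"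
    using assms False by (intro Youngs_inequality_0) auto
  also have "(a powr r) powr (1/r) * (s powr r) powr (1 - 1/r) = a * s powr (r - 1)"
    using assms False by (simp add: powr_powr right_diff_distrib)
  finally have "r * (a * s powr (r - 1)) \<le> r * (1/r * a powr r + (1 - 1/r) * s powr r)"
    using assms by (intro mult_left_mono) auto
  also have "\<dots> = a powr r + (r - 1) * s powr r" using assms by (simp add: field_simps)
  finally show ?thesis by (simp add: mult_ac)
qed

text \<open>
  Jensen's inequality for the measure with density \<open>k\<close>. Integrating the tangent inequality at
  \<open>s = t / A\<close> against \<open>k\<close> bounds \<open>t\<^sup>r\<close>. Nonnegative integrals are used so that
  the inequality applies in Schur's test also at points where the right-hand side is infinite.
\<close>

lemma weighted_Jensen_powr:
  fixes k f :: "'b \<Rightarrow> real"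
  assumes [measurable]: "k \<in> borel_measurable M" "f \<in> borel_measurable M"
    and k: "\<And>x. 0 \<le> k x" and f: "\<And>x. 0 \<le> f x" and r: "1 \<le> r" and A: "0 < A"
    and kA: "(\<integral>\<^sup>+ x. ennreal (k x) \<partial>M) \<le> ennreal A"
    and t: "0 \<le> t" "ennreal t \<le> (\<integral>\<^sup>+ x. ennreal (k x * f x) \<partial>M)"
  shows "ennreal (t powr r) \<le> ennreal (A powr (r - 1)) * (\<integral>\<^sup>+ x. ennreal (k x * f x powr r) \<partial>M)"
proof (cases "t = 0 \<or> (\<integral>\<^sup>+ x. ennreal (k x * f x powr r) \<partial>M) = \<infinity>")
  case True
  then show ?thesis using A by (auto simp: ennreal_mult_top)
next
  case False
  \<comment> \<open>The mean of \<open>f\<close> with respect to the weight \<open>k\<close>, up to the slack in the two bounds.\<close>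
  define s where "s = t / A"
  have s: "0 < s" using False t A by (simp add: s_def)
  obtain i where i: "(\<integral>\<^sup>+ x. ennreal (k x * f x powr r) \<partial>M) = ennreal i" "0 \<le> i"
    using False by (cases "\<integral>\<^sup>+ x. ennreal (k x * f x powr r) \<partial>M") auto
  have "ennreal (r * s powr (r - 1) * t) \<le>
        ennreal (r * s powr (r - 1)) * (\<integral>\<^sup>+ x. ennreal (k x * f x) \<partial>M)"
    using t r by (subst ennreal_mult) (auto intro!: mult_left_mono)
  also have "\<dots> = (\<integral>\<^sup>+ x. ennreal (k x * (r * s powr (r - 1) * f x)) \<partial>M)"
    using r by (subst nn_integral_cmult[symmetric]) (auto simp: k f mult_ac simp flip: ennreal_mult)
  also have "\<dots> \<le> (\<integral>\<^sup>+ x. ennreal (k x * f x powr r) + ennreal ((r - 1) * s powr r) * ennreal (k x) \<partial>M)"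
  proof (rule nn_integral_mono)
    fix x
    have "k x * (r * s powr (r - 1) * f x) \<le> k x * (f x powr r + (r - 1) * s powr r)"
      using tangent_line_powr[OF r f s] k by (intro mult_left_mono) auto
    also have "\<dots> = k x * f x powr r + (r - 1) * s powr r * k x" by (simp add: algebra_simps)
    finally show "ennreal (k x * (r * s powr (r - 1) * f x)) \<le>
      ennreal (k x * f x powr r) + ennreal ((r - 1) * s powr r) * ennreal (k x)"
      using k r by (simp flip: ennreal_mult ennreal_plus)
  qed
  also have "\<dots> = ennreal i + ennreal ((r - 1) * s powr r) * (\<integral>\<^sup>+ x. ennreal (k x) \<partial>M)"
    by (subst nn_integral_add) (auto simp: nn_integral_cmult i)
  also have "\<dots> \<le> ennreal i + ennreal ((r - 1) * s powr r) * ennreal A"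
    using kA by (intro add_left_mono mult_left_mono) auto
  also have "\<dots> = ennreal (i + (r - 1) * s powr r * A)"
    using r i A by (simp flip: ennreal_mult ennreal_plus)
  finally have "ennreal (r * s powr (r - 1) * t) \<le> ennreal (i + (r - 1) * s powr r * A)" .
  then have "r * s powr (r - 1) * t \<le> i + (r - 1) * s powr r * A"
    using r i A by (subst (asm) ennreal_le_iff) auto
  moreover have "s powr r * A = s powr (r - 1) * t"
    using s A False t by (simp add: powr_diff s_def)
  ultimately have le: "s powr (r - 1) * t \<le> i"
    by (simp add: mult.assoc) (simp add: algebra_simps)
  have "t powr r = A powr (r - 1) * (s powr (r - 1) * t)"
    using s A t False by (simp add: s_def powr_divide powr_diff)
  also have "\<dots> \<le> A powr (r - 1) * i" using le by (intro mult_left_mono) auto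
  finally show ?thesis using i by (simp flip: ennreal_mult)
qed

lemma sum_fun_apply: "(\<Sum>k\<in>K. F k) x = (\<Sum>k\<in>K. F k x)"
  for F :: "'k \<Rightarrow> 'a \<Rightarrow> 'b::comm_monoid_add"
  by (induction K rule: infinite_finite_induct) auto

text \<open>
  Minkowski's inequality up to a constant factor, which is enough to pass the approximation property
  to sums. Pointwise, the sum is at most \<open>\<Sum>\<bar>c k\<bar>\<close> times the maximum of the \<open>\<bar>f k x\<bar>\<close>, whose \<open>r\<close>-th
  power is at most the sum of the \<open>r\<close>-th powers. Adding \<open>1\<close> to
  both constants keeps the factor positive, so that the right-hand side is infinite as soon as one
  of the norms is.
\<close>

lemma Lp_norm_sum_le:
  fixes f :: "'k \<Rightarrow> 'a::euclidean_space \<Rightarrow> real" and c :: "'k \<Rightarrow> real"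
  assumes K: "finite K" and f: "\<And>k. k \<in> K \<Longrightarrow> f k \<in> borel_measurable (lebesgue_on S)" and p: "1 \<le> p"
  shows "Lp_norm p S (\<Sum>k\<in>K. c k *\<^sub>R f k) \<le>
    ennreal (((\<Sum>k\<in>K. \<bar>c k\<bar>) + 1) * (real (card K) + 1)) * (\<Sum>k\<in>K. Lp_norm p S (f k))"
proof -
  define M n where "M = (\<Sum>k\<in>K. \<bar>c k\<bar>) + 1" and "n = real (card K) + 1"
  have M: "1 \<le> M" and n: "1 \<le> n" by (auto simp: M_def n_def sum_nonneg)
  have Mn: "0 < M * n" using M n by simp
  define F where "F = (\<Sum>k\<in>K. c k *\<^sub>R f k)"
  have F: "F x = (\<Sum>k\<in>K. c k * f k x)" for x
    unfolding F_def sum_fun_apply by (simp add: scaleR_fun_def)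
  have "(\<lambda>x. \<Sum>k\<in>K. c k * f k x) \<in> borel_measurable (lebesgue_on S)"
    using f by (intro borel_measurable_sum borel_measurable_times) auto
  then have Fm: "F \<in> borel_measurable (lebesgue_on S)" by (simp add: F[abs_def, symmetric] F cong: measurable_cong)
  have Fmax: "\<bar>F x\<bar> \<le> M * b" if "0 \<le> b" "\<And>k. k \<in> K \<Longrightarrow> \<bar>f k x\<bar> \<le> b" for x b
  proof -
    have "\<bar>F x\<bar> \<le> (\<Sum>k\<in>K. \<bar>c k\<bar> * \<bar>f k x\<bar>)"
      unfolding F by (rule order_trans[OF sum_abs]) (simp add: abs_mult)
    also have "\<dots> \<le> (\<Sum>k\<in>K. \<bar>c k\<bar> * b)" using that by (intro sum_mono mult_left_mono) auto
    also have "\<dots> \<le> M * b" using that by (simp add: M_def sum_distrib_right[symmetric] mult_right_mono)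
    finally show ?thesis .
  qed
  show ?thesis
  proof (cases "\<exists>k\<in>K. Lp_norm p S (f k) = \<infinity>")
    case True
    then obtain j where j: "j \<in> K" "Lp_norm p S (f j) = \<infinity>" by blast
    then have "\<infinity> \<le> (\<Sum>k\<in>K. Lp_norm p S (f k))"
      using K member_le_sum[of j K "\<lambda>k. Lp_norm p S (f k)"] by simp
    then have "(\<Sum>k\<in>K. Lp_norm p S (f k)) = \<infinity>" by (simp add: top_unique)
    then show ?thesis
      using Mn M n unfolding M_def[symmetric] n_def[symmetric] by (simp add: ennreal_mult_top)
  next
    case False
    define a where "a k = enn2real (Lp_norm p S (f k))" for k
    have a: "Lp_norm p S (f k) = ennreal (a k)" if "k \<in> K" for k
      using False that by (auto simp: a_def less_top)
    have a0: "0 \<le> a k" for k by (simp add: a_def)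
    define s where "s = (\<Sum>k\<in>K. a k)"
    have s0: "0 \<le> s" by (simp add: s_def sum_nonneg a0)
    have as: "a k \<le> s" if "k \<in> K" for k
      unfolding s_def using K that a0 by (intro member_le_sum) auto
    have sum_s: "(\<Sum>k\<in>K. Lp_norm p S (f k)) = ennreal s"
      using a by (simp add: s_def a0)
    have t0: "0 \<le> M * n * s" using M n s0 by simp
    have "Lp_norm p S F \<le> ennreal (M * n * s)"
    proof (cases "p = \<infinity>")
      case True
      have "AE x in lebesgue_on S. \<bar>f k x\<bar> \<le> a k" if "k \<in> K" for k
        using Lp_norm_top_le_iff[OF f[OF that] a0[of k]] a[OF that] True by simp
      then have "AE x in lebesgue_on S. \<forall>k\<in>K. \<bar>f k x\<bar> \<le> a k"
        using K by (intro AE_finite_allI) auto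
      then have "AE x in lebesgue_on S. \<bar>F x\<bar> \<le> M * n * s"
      proof eventually_elim
        case (elim x)
        have "\<bar>F x\<bar> \<le> M * s" using elim as s0 by (intro Fmax) (auto intro: order_trans)
        also have "\<dots> \<le> M * s * n" using M n s0 by (intro mult_left_mono[of 1 n "M * s", simplified]) auto
        finally show ?case by (simp add: mult_ac)
      qed
      then show ?thesis using Lp_norm_top_le_iff[OF Fm t0] True by simp
    next
      case False
      define r where "r = enn2real p"
      have r: "1 \<le> r" using enn2real_ge_one[OF p False] by (simp add: r_def)
      have I: "(\<integral>\<^sup>+ x. ennreal (\<bar>f k x\<bar> powr r) \<partial>lebesgue_on S) \<le> ennreal (s powr r)" if "k \<in> K" for k
      proof -
        have "Lp_norm p S (f k) \<le> ennreal s" using a[OF that] as[OF that] by (simp add: ennreal_leI)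
        then show ?thesis unfolding Lp_norm_le_iff[OF p False s0] r_def .
      qed
      have pm: "(\<lambda>x. ennreal (\<bar>f k x\<bar> powr r)) \<in> borel_measurable (lebesgue_on S)" if "k \<in> K" for k
        using f[OF that] by measurable
      have "\<bar>F x\<bar> powr r \<le> M powr r * (\<Sum>k\<in>K. \<bar>f k x\<bar> powr r)" for x
      proof (cases "K = {}")
        case True
        then show ?thesis by (simp add: F)
      next
        case False
        define b where "b = Max ((\<lambda>k. \<bar>f k x\<bar>) ` K)"
        have "b \<in> (\<lambda>k. \<bar>f k x\<bar>) ` K" unfolding b_def using K False by (intro Max_in) auto
        then obtain j where j: "j \<in> K" "b = \<bar>f j x\<bar>" by auto
        have "\<bar>f k x\<bar> \<le> b" if "k \<in> K" for k
          unfolding b_def using K that by (intro Max_ge) auto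
        then have "\<bar>F x\<bar> \<le> M * b" using j by (intro Fmax) auto
        then have "\<bar>F x\<bar> powr r \<le> (M * b) powr r" using r by (intro powr_mono2) auto
        also have "\<dots> = M powr r * \<bar>f j x\<bar> powr r" using M j by (simp add: powr_mult)
        also have "\<dots> \<le> M powr r * (\<Sum>k\<in>K. \<bar>f k x\<bar> powr r)"
          using K j by (intro mult_left_mono member_le_sum) auto
        finally show ?thesis .
      qed
      then have "(\<integral>\<^sup>+ x. ennreal (\<bar>F x\<bar> powr r) \<partial>lebesgue_on S) \<le>
        (\<integral>\<^sup>+ x. ennreal (M powr r) * (\<Sum>k\<in>K. ennreal (\<bar>f k x\<bar> powr r)) \<partial>lebesgue_on S)"
        by (intro nn_integral_mono) (simp add: sum_nonneg ennreal_leI flip: ennreal_mult)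
      also have "\<dots> = ennreal (M powr r) * (\<Sum>k\<in>K. \<integral>\<^sup>+ x. ennreal (\<bar>f k x\<bar> powr r) \<partial>lebesgue_on S)"
        by (simp only: nn_integral_cmult[OF borel_measurable_sum[OF pm]] nn_integral_sum[OF pm])
      also have "\<dots> \<le> ennreal (M powr r) * (\<Sum>k\<in>K. ennreal (s powr r))"
        using I by (intro mult_left_mono sum_mono) auto
      also have "\<dots> = ennreal (M powr r * (real (card K) * s powr r))"
        by (simp add: ennreal_mult ennreal_of_nat_eq_real_of_nat)
      also have "\<dots> \<le> ennreal (M powr r * (n powr r * s powr r))"
      proof (intro ennreal_leI mult_left_mono mult_right_mono)
        have "n powr 1 \<le> n powr r" using r n by (intro powr_mono) auto
        then show "real (card K) \<le> n powr r" using n by (simp add: n_def)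
      qed auto
      also have "\<dots> = ennreal ((M * n * s) powr r)"
        using M n s0 by (simp add: powr_mult)
      finally show ?thesis unfolding Lp_norm_le_iff[OF p False t0] r_def .
    qed
    then show ?thesis
      unfolding sum_s using M n s0 by (simp add: F_def M_def n_def flip: ennreal_mult)
  qed
qed

lemma Lp_norm_scaleR_le:
  fixes f :: "'a::euclidean_space \<Rightarrow> real"
  assumes "f \<in> borel_measurable (lebesgue_on S)" "1 \<le> p"
  shows "Lp_norm p S (c *\<^sub>R f) \<le> ennreal ((\<bar>c\<bar> + 1) * 2) * Lp_norm p S f"
  using Lp_norm_sum_le[of "{()}" "\<lambda>_. f" S p "\<lambda>_. c"] assms by simp

lemma subspace_Lp_space:
  assumes p: "1 \<le> p"
  shows "subspace (Lp_space p S)"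
proof (rule subspaceI)
  show "0 \<in> Lp_space p S"
    using Lp_norm_eq_0_iff[of "\<lambda>x. 0" S p] p by (simp add: Lp_space_def zero_fun_def)
next
  fix u v assume uv: "u \<in> Lp_space p S" "v \<in> Lp_space p S"
  then have m: "u \<in> borel_measurable (lebesgue_on S)" "v \<in> borel_measurable (lebesgue_on S)"
    by (auto simp: Lp_space_def)
  have "(\<lambda>x. u x + v x) \<in> borel_measurable (lebesgue_on S)" using m by measurable
  then have "u + v \<in> borel_measurable (lebesgue_on S)" by (simp add: plus_fun_def)
  moreover have "Lp_norm p S (u + v) \<le> ennreal 9 * (Lp_norm p S u + Lp_norm p S v)"
    using Lp_norm_sum_le[of UNIV "\<lambda>b. if b then u else v" S p "\<lambda>_. 1"] m p
    by (simp add: UNIV_bool add.commute)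
  then have "Lp_norm p S (u + v) < \<infinity>"
    using uv by (auto simp: Lp_space_def ennreal_mult_less_top intro: le_less_trans)
  ultimately show "u + v \<in> Lp_space p S" by (simp add: Lp_space_def)
next
  fix a :: real and u assume u: "u \<in> Lp_space p S"
  then have m: "u \<in> borel_measurable (lebesgue_on S)" by (auto simp: Lp_space_def)
  then have "(\<lambda>x. a * u x) \<in> borel_measurable (lebesgue_on S)" by measurable
  then have "a *\<^sub>R u \<in> borel_measurable (lebesgue_on S)" by (simp add: scaleR_fun_def)
  moreover have "Lp_norm p S (a *\<^sub>R u) < \<infinity>"
    using u by (intro le_less_trans[OF Lp_norm_scaleR_le[OF m p]]) (auto simp: Lp_space_def ennreal_mult_less_top)
  ultimately show "a *\<^sub>R u \<in> Lp_space p S" by (simp add: Lp_space_def)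
qed

section \<open>Translations and discretisation of integrable kernels\<close>

lemma lborel_distr_reflect:
  fixes c :: "'a::euclidean_space"
  shows "distr lborel borel (\<lambda>x. c - x) = lborel"
proof -
  have "distr lborel borel (\<lambda>x::'a. c - x) = density (distr lborel borel (\<lambda>x. c + (-1) *\<^sub>R x)) (\<lambda>_. 1)"
    by (simp add: density_1)
  then show ?thesis by (subst lborel_affine[of "-1" c]) auto
qed

lemma nn_integral_lborel_translate:
  fixes c :: "'a::euclidean_space"
  assumes [measurable]: "f \<in> borel_measurable borel"
  shows "(\<integral>\<^sup>+ x. f (x - c) \<partial>lborel) = (\<integral>\<^sup>+ x. f x \<partial>lborel)"
  by (subst (2) lborel_distr_plus[of "-c", symmetric]) (simp add: nn_integral_distr)

lemma nn_integral_lborel_reflect: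
  fixes c :: "'a::euclidean_space"
  assumes [measurable]: "f \<in> borel_measurable borel"
  shows "(\<integral>\<^sup>+ x. f (c - x) \<partial>lborel) = (\<integral>\<^sup>+ x. f x \<partial>lborel)"
  by (subst (2) lborel_distr_reflect[of c, symmetric]) (simp add: nn_integral_distr)

lemma integral_lborel_translate:
  fixes c :: "'a::euclidean_space" and f :: "'a \<Rightarrow> real"
  assumes [measurable]: "f \<in> borel_measurable borel"
  shows "(\<integral> x. f (x - c) \<partial>lborel) = (\<integral> x. f x \<partial>lborel)"
  by (subst (2) lborel_distr_plus[of "-c", symmetric]) (simp add: integral_distr)

lemma AE_lborel_translate:
  fixes c :: "'a::euclidean_space"
  assumes "AE y in lborel. P y"
  shows "AE x in lborel. P (c + x)"
proof -
  have "AE y in distr lborel borel ((+) c). P y" using assms unfolding lborel_distr_plus .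
  then show ?thesis by (rule AE_distrD[rotated]) simp
qed

text \<open>
  Truncating \<open>g\<close> at a large height \<open>B\<close> changes it little in \<open>L\<^sup>1\<close>. The continuous functions
  that converge to \<open>g\<close> almost everywhere, truncated at the same height, converge to the truncated
  \<open>g\<close> in \<open>L\<^sup>1(K)\<close> because they are dominated by a constant.
\<close>

lemma continuous_approximation_L1:
  fixes g :: "'a::euclidean_space \<Rightarrow> real"
  assumes g: "integrable lborel g" and K: "compact K" and e: "0 < e"
  shows "\<exists>h. continuous_on UNIV h \<and> (\<integral>\<^sup>+ y. ennreal (indicator K y * \<bar>g y - h y\<bar>) \<partial>lborel) \<le> ennreal e"
proof -
  have [measurable]: "g \<in> borel_measurable borel" using g by auto
  have [measurable]: "K \<in> sets borel" using K by (simp add: borel_compact)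
  define cl where "cl B t = max (-B) (min B t)" for B t :: real
  have cl_cont: "continuous_on UNIV (cl B)" for B unfolding cl_def by (intro continuous_intros)
  have [measurable]: "cl B \<in> borel_measurable borel" for B
    using cl_cont by (rule borel_measurable_continuous_onI)
  have "(\<lambda>n. \<integral>\<^sup>+ y. ennreal \<bar>g y - cl (real n) (g y)\<bar> \<partial>lborel) \<longlonglongrightarrow> (\<integral>\<^sup>+ y. 0 \<partial>(lborel::'a measure))"
  proof (rule nn_integral_dominated_convergence[where w="\<lambda>y. ennreal \<bar>g y\<bar>"])
    show "(\<integral>\<^sup>+ y. ennreal \<bar>g y\<bar> \<partial>lborel) < \<infinity>"
      using g by (simp add: integrable_iff_bounded)
    show "AE y in lborel. (\<lambda>n. ennreal \<bar>g y - cl (real n) (g y)\<bar>) \<longlonglongrightarrow> 0"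
    proof (rule AE_I2)
      fix y
      have "\<forall>\<^sub>F n in sequentially. cl (real n) (g y) = g y"
        using eventually_ge_at_top[of "nat \<lceil>\<bar>g y\<bar>\<rceil>"]
        by eventually_elim (auto simp: cl_def)
      then show "(\<lambda>n. ennreal \<bar>g y - cl (real n) (g y)\<bar>) \<longlonglongrightarrow> 0"
        by (intro tendsto_eventually) (auto elim!: eventually_mono)
    qed
  qed (auto simp: cl_def intro!: AE_I2 ennreal_leI)
  then have "\<forall>\<^sub>F n in sequentially. (\<integral>\<^sup>+ y. ennreal \<bar>g y - cl (real n) (g y)\<bar> \<partial>lborel) < ennreal (e/2)"
    using e by (intro order_tendstoD(2)) auto
  then obtain n where n: "(\<integral>\<^sup>+ y. ennreal \<bar>g y - cl (real n) (g y)\<bar> \<partial>lborel) < ennreal (e/2)"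
    by (auto simp: eventually_sequentially)
  define B where "B = real n"
  have "g measurable_on UNIV"
    by (intro lebesgue_measurable_imp_measurable_on_real) (auto intro: measurable_completion)
  then obtain Z G where Z: "negligible Z" and G: "\<And>m. continuous_on UNIV (G m)"
    and lim: "\<And>y. y \<notin> Z \<Longrightarrow> (\<lambda>m. G m y) \<longlonglongrightarrow> g y"
    unfolding measurable_on_def by auto
  have [measurable]: "G m \<in> borel_measurable borel" for m
    using G by (rule borel_measurable_continuous_onI)
  have "AE y in lebesgue. y \<notin> Z"
    using Z by (intro AE_not_in) (simp add: negligible_iff_null_sets)
  then have Z': "AE y in lborel. y \<notin> Z" by (simp add: AE_completion_iff)
  have "(\<lambda>m. \<integral>\<^sup>+ y. ennreal (indicator K y * \<bar>cl B (g y) - cl B (G m y)\<bar>) \<partial>lborel) \<longlonglongrightarrow> (\<integral>\<^sup>+ y. 0 \<partial>(lborel::'a measure))"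
  proof (rule nn_integral_dominated_convergence[where w="\<lambda>y. ennreal (2 * B) * indicator K y"])
    show "(\<integral>\<^sup>+ y. ennreal (2 * B) * indicator K y \<partial>lborel) < \<infinity>"
      using K emeasure_compact_finite[OF K]
      by (subst nn_integral_cmult_indicator) (auto simp: ennreal_mult_less_top)
    show "AE y in lborel. ennreal (indicator K y * \<bar>cl B (g y) - cl B (G m y)\<bar>) \<le> ennreal (2 * B) * indicator K y" for m
      by (rule AE_I2) (auto simp: cl_def B_def indicator_def intro!: ennreal_leI)
    show "AE y in lborel. (\<lambda>m. ennreal (indicator K y * \<bar>cl B (g y) - cl B (G m y)\<bar>)) \<longlonglongrightarrow> 0"
      using Z'
    proof eventually_elim
      case (elim y)
      have "(\<lambda>m. indicator K y * \<bar>cl B (g y) - cl B (G m y)\<bar>) \<longlonglongrightarrow> indicator K y * \<bar>cl B (g y) - cl B (g y)\<bar>"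
        unfolding cl_def by (intro tendsto_intros lim elim)
      then show ?case using tendsto_ennrealI by fastforce
    qed
  qed auto
  then have "\<forall>\<^sub>F m in sequentially. (\<integral>\<^sup>+ y. ennreal (indicator K y * \<bar>cl B (g y) - cl B (G m y)\<bar>) \<partial>lborel) < ennreal (e/2)"
    using e by (intro order_tendstoD(2)) auto
  then obtain m where m: "(\<integral>\<^sup>+ y. ennreal (indicator K y * \<bar>cl B (g y) - cl B (G m y)\<bar>) \<partial>lborel) < ennreal (e/2)"
    by (auto simp: eventually_sequentially)
  have "(\<integral>\<^sup>+ y. ennreal (indicator K y * \<bar>g y - cl B (G m y)\<bar>) \<partial>lborel) \<le>
    (\<integral>\<^sup>+ y. ennreal \<bar>g y - cl B (g y)\<bar> + ennreal (indicator K y * \<bar>cl B (g y) - cl B (G m y)\<bar>) \<partial>lborel)"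
    by (intro nn_integral_mono) (auto simp: indicator_def simp flip: ennreal_plus)
  also have "\<dots> = (\<integral>\<^sup>+ y. ennreal \<bar>g y - cl B (g y)\<bar> \<partial>lborel) +
     (\<integral>\<^sup>+ y. ennreal (indicator K y * \<bar>cl B (g y) - cl B (G m y)\<bar>) \<partial>lborel)"
    by (intro nn_integral_add) auto
  also have "\<dots> \<le> ennreal (e/2) + ennreal (e/2)"
    using n m unfolding B_def by (intro add_mono less_imp_le)
  also have "\<dots> = ennreal e" using e by (simp flip: ennreal_plus)
  finally have "(\<integral>\<^sup>+ y. ennreal (indicator K y * \<bar>g y - cl B (G m y)\<bar>) \<partial>lborel) \<le> ennreal e" .
  moreover have "continuous_on UNIV (\<lambda>y. cl B (G m y))"
    using continuous_on_compose2[OF cl_cont G] by auto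
  ultimately show ?thesis by blast
qed

text \<open>
  The bounded set \<open>S\<close> is covered by finitely many balls of radius \<open>d\<close>, and \<open>q\<close> sends a point to
  the centre of one of the balls that contain it.
\<close>

lemma finite_range_discretisation:
  fixes S :: "'a::euclidean_space set"
  assumes "bounded S" "0 < d"
  shows "\<exists>q. q \<in> borel_measurable borel \<and> finite (range q) \<and> (\<forall>x\<in>S. dist (q x) x < d)"
proof -
  have "compact (closure S)" using assms(1) by simp
  then obtain C where C: "finite C" "closure S \<subseteq> (\<Union>c\<in>C. ball c d)"
    using assms(2) unfolding compact_eq_totally_bounded by blast
  have "\<exists>q::'a \<Rightarrow> 'a. q \<in> borel_measurable borel \<and> finite (range q) \<and> (\<forall>x\<in>(\<Union>c\<in>C. ball c d). dist (q x) x < d)"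
    using C(1)
  proof (induction C rule: finite_induct)
    case empty
    then show ?case by (intro exI[of _ "\<lambda>x. 0"]) auto
  next
    case (insert c C)
    then obtain q :: "'a \<Rightarrow> 'a" where [measurable]: "q \<in> borel_measurable borel" and q: "finite (range q)"
      "\<forall>x\<in>(\<Union>c\<in>C. ball c d). dist (q x) x < d" by blast
    let ?q = "\<lambda>x. if x \<in> ball c d then c else q x"
    have "?q \<in> borel_measurable borel"
      by (intro measurable_If_set) auto
    moreover have "finite (range ?q)"
      by (rule finite_subset[of _ "insert c (range q)"]) (use q in auto)
    moreover have "\<forall>x\<in>(\<Union>c\<in>insert c C. ball c d). dist (?q x) x < d" using q(2) by auto
    ultimately show ?case by blast
  qed
  with C(2) closure_subset[of S] show ?thesis by blast
qed

text \<open>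
  The arguments of \<open>h\<close> stay in a fixed compact ball, on which \<open>h\<close> is uniformly continuous.
\<close>

lemma translation_modulus:
  fixes h :: "'a::euclidean_space \<Rightarrow> real"
  assumes h: "continuous_on UNIV h" and S: "bounded S" and E: "bounded E" and \<eta>: "0 < \<eta>"
  shows "\<exists>d>0. \<forall>x\<in>S. \<forall>y\<in>E. \<forall>x'. dist x' x < d \<longrightarrow> \<bar>h (y - x) - h (y - x')\<bar> \<le> \<eta>"
proof -
  obtain R where R: "\<And>x. x \<in> S \<Longrightarrow> norm x \<le> R" "\<And>x. x \<in> E \<Longrightarrow> norm x \<le> R"
    using bounded_Un[of S E] S E unfolding bounded_iff by auto
  have "uniformly_continuous_on (cball 0 (2 * R + 1)) h"
    by (intro compact_uniformly_continuous continuous_on_subset[OF h]) auto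
  then obtain d where d: "d > 0" and hd: "\<And>a b. a \<in> cball 0 (2*R+1) \<Longrightarrow> b \<in> cball 0 (2*R+1) \<Longrightarrow>
     dist b a < d \<Longrightarrow> dist (h b) (h a) < \<eta>"
    using \<eta> unfolding uniformly_continuous_on_def by metis
  have "\<bar>h (y - x) - h (y - x')\<bar> \<le> \<eta>" if "x \<in> S" "y \<in> E" "dist x' x < min d 1" for x y x'
  proof -
    have n: "norm x \<le> R" "norm y \<le> R" using R that by auto
    have x': "norm x' \<le> norm x + 1"
      using that(3) norm_triangle_ineq[of x "x' - x"] by (auto simp: dist_norm)
    have "norm (y - x) \<le> 2*R+1" using n norm_triangle_ineq4[of y x] by linarith
    moreover have "norm (y - x') \<le> 2*R+1" using n x' norm_triangle_ineq4[of y x'] by linarith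
    moreover have "dist (y - x) (y - x') < d" using that(3) by (auto simp: dist_norm)
    ultimately have "dist (h (y - x)) (h (y - x')) < \<eta>" using hd by auto
    then show ?thesis by (simp add: dist_real_def)
  qed
  with d show ?thesis by (intro exI[of _ "min d 1"]) auto
qed

text \<open>
  The kernel is at most \<open>\<bar>g(y - x) - h(y - x)\<bar>\<close> plus \<open>\<bar>h(y - x) - h(y - q x)\<bar>\<close>. For \<open>x\<close> in \<open>S\<close> and
  \<open>y\<close> in \<open>E\<close> the difference \<open>y - x\<close> stays in a compact ball \<open>K\<close>, so the first part integrates in either
  variable to at most the \<open>L\<^sup>1(K)\<close> distance of \<open>g\<close> and \<open>h\<close>, by invariance of Lebesgue measure under
  translations and reflections. The second part is uniformly small because \<open>h\<close> is continuous, which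
  is the reason to discretise \<open>h\<close> instead of \<open>g\<close>.
\<close>

lemma kernel_discretisation:
  fixes g :: "'a::euclidean_space \<Rightarrow> real"
  assumes g: "integrable lborel g" and S: "open S" "bounded S" and E: "open E" "bounded E" and e: "0 < e"
  shows "\<exists>h q. continuous_on UNIV h \<and> q \<in> borel_measurable borel \<and> finite (range q) \<and>
    (\<forall>x. (\<integral>\<^sup>+ y. ennreal (indicator S x * indicator E y * \<bar>g (y - x) - h (y - q x)\<bar>) \<partial>lborel) \<le> ennreal e) \<and>
    (\<forall>y. (\<integral>\<^sup>+ x. ennreal (indicator S x * indicator E y * \<bar>g (y - x) - h (y - q x)\<bar>) \<partial>lborel) \<le> ennreal e)"
proof -
  have [measurable]: "g \<in> borel_measurable borel" using g by auto
  have [measurable]: "S \<in> sets borel" "E \<in> sets borel" using S E by auto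
  obtain R where R: "\<And>x. x \<in> S \<Longrightarrow> norm x \<le> R" "\<And>x. x \<in> E \<Longrightarrow> norm x \<le> R"
    using bounded_Un[of S E] S E unfolding bounded_iff by auto
  define K where "K = cball (0::'a) (2 * R)"
  have yx: "y - x \<in> K" if "x \<in> S" "y \<in> E" for x y
    using R(1)[OF that(1)] R(2)[OF that(2)] norm_triangle_ineq4[of y x] by (simp add: K_def)
  have [measurable]: "K \<in> sets borel" by (simp add: K_def)
  have "compact K" by (simp add: K_def)
  from continuous_approximation_L1[OF g this, of "e/2"] e obtain h where h: "continuous_on UNIV h"
    "(\<integral>\<^sup>+ z. ennreal (indicator K z * \<bar>g z - h z\<bar>) \<partial>lborel) \<le> ennreal (e/2)" by auto
  have [measurable]: "h \<in> borel_measurable borel" using h(1) by (rule borel_measurable_continuous_onI)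
  define mS mE where "mS = measure lborel S" and "mE = measure lborel E"
  have mS: "emeasure lborel S = ennreal mS" and mE: "emeasure lborel E = ennreal mE"
    using S(2) E(2) emeasure_bounded_finite
    by (auto simp: mS_def mE_def intro!: emeasure_eq_ennreal_measure simp: less_top[symmetric])
  have nn: "0 \<le> mS" "0 \<le> mE" by (auto simp: mS_def mE_def)
  \<comment> \<open>The error \<open>\<eta>\<close> is integrated over \<open>E\<close> or over \<open>S\<close>; in both cases half of \<open>e\<close> is available.\<close>
  define \<eta> where "\<eta> = (e / 2) / (mS + mE + 1)"
  have \<eta>: "0 < \<eta>" using e nn by (simp add: \<eta>_def)
  have \<eta>m: "\<eta> * m \<le> e / 2" if "0 \<le> m" "m \<le> mS + mE" for m
  proof -
    have "\<eta> * m \<le> \<eta> * (mS + mE + 1)" using that \<eta> by (intro mult_left_mono) auto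
    also have "\<dots> = e / 2"
      using nonzero_divide_eq_eq[of "mS + mE + 1" "e / 2" \<eta>] nn \<eta>_def by auto
    finally show ?thesis .
  qed
  obtain d where d: "d > 0"
    "\<And>x y x'. x \<in> S \<Longrightarrow> y \<in> E \<Longrightarrow> dist x' x < d \<Longrightarrow> \<bar>h (y - x) - h (y - x')\<bar> \<le> \<eta>"
    using translation_modulus[OF h(1) S(2) E(2) \<eta>] by blast
  obtain q :: "'a \<Rightarrow> 'a" where q: "q \<in> borel_measurable borel" "finite (range q)" "\<And>x. x \<in> S \<Longrightarrow> dist (q x) x < d"
    using finite_range_discretisation[OF S(2) d(1)] by blast
  note [measurable] = q(1)
  define F where "F z = ennreal (indicator K z * \<bar>g z - h z\<bar>)" for z
  have [measurable]: "F \<in> borel_measurable borel" unfolding F_def by measurable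
  let ?k = "\<lambda>x y. ennreal (indicator S x * indicator E y * \<bar>g (y - x) - h (y - q x)\<bar>)"
  have le: "?k x y \<le> F (y - x) + ennreal \<eta> * (indicator S x * indicator E y)" for x y
  proof (cases "x \<in> S \<and> y \<in> E")
    case True
    have "\<bar>g (y - x) - h (y - q x)\<bar> \<le> \<bar>g (y - x) - h (y - x)\<bar> + \<eta>"
      using d(2)[of x y "q x"] q(3)[of x] True by linarith
    then show ?thesis using True yx \<eta> by (simp add: F_def flip: ennreal_plus)
  next
    case False
    then show ?thesis by (auto simp: indicator_def)
  qed
  have "(\<integral>\<^sup>+ y. ?k x y \<partial>lborel) \<le> ennreal e" for x
  proof -
    have "(\<integral>\<^sup>+ y. ?k x y \<partial>lborel) \<le> (\<integral>\<^sup>+ y. F (y - x) + ennreal \<eta> * indicator E y \<partial>lborel)"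
    proof (rule nn_integral_mono)
      fix y
      have "ennreal \<eta> * (indicator S x * indicator E y) \<le> ennreal \<eta> * indicator E y"
        by (auto simp: indicator_def)
      with le[of x y] show "?k x y \<le> F (y - x) + ennreal \<eta> * indicator E y"
        by (meson add_left_mono order_trans)
    qed
    also have "\<dots> = (\<integral>\<^sup>+ y. F (y - x) \<partial>lborel) + ennreal \<eta> * ennreal mE"
      by (subst nn_integral_add) (auto simp: nn_integral_cmult_indicator mE)
    also have "(\<integral>\<^sup>+ y. F (y - x) \<partial>lborel) = (\<integral>\<^sup>+ z. F z \<partial>lborel)" by (rule nn_integral_lborel_translate) simp
    also have "\<dots> + ennreal \<eta> * ennreal mE \<le> ennreal (e/2) + ennreal (e/2)"
      using h(2) \<eta>m[of mE] nn \<eta> unfolding F_def by (intro add_mono) (auto simp flip: ennreal_mult intro!: ennreal_leI)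
    also have "\<dots> = ennreal e" using e by (simp flip: ennreal_plus)
    finally show ?thesis .
  qed
  moreover have "(\<integral>\<^sup>+ x. ?k x y \<partial>lborel) \<le> ennreal e" for y
  proof -
    have "(\<integral>\<^sup>+ x. ?k x y \<partial>lborel) \<le> (\<integral>\<^sup>+ x. F (y - x) + ennreal \<eta> * indicator S x \<partial>lborel)"
    proof (rule nn_integral_mono)
      fix x
      have "ennreal \<eta> * (indicator S x * indicator E y) \<le> ennreal \<eta> * indicator S x"
        by (auto simp: indicator_def)
      with le[of x y] show "?k x y \<le> F (y - x) + ennreal \<eta> * indicator S x"
        by (meson add_left_mono order_trans)
    qed
    also have "\<dots> = (\<integral>\<^sup>+ x. F (y - x) \<partial>lborel) + ennreal \<eta> * ennreal mS"
      by (subst nn_integral_add) (auto simp: nn_integral_cmult_indicator mS)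
    also have "(\<integral>\<^sup>+ x. F (y - x) \<partial>lborel) = (\<integral>\<^sup>+ z. F z \<partial>lborel)" by (rule nn_integral_lborel_reflect) simp
    also have "\<dots> + ennreal \<eta> * ennreal mS \<le> ennreal (e/2) + ennreal (e/2)"
      using h(2) \<eta>m[of mS] nn \<eta> unfolding F_def by (intro add_mono) (auto simp flip: ennreal_mult intro!: ennreal_leI)
    also have "\<dots> = ennreal e" using e by (simp flip: ennreal_plus)
    finally show ?thesis .
  qed
  ultimately show ?thesis using h(1) q(1,2) by blast
qed

section \<open>Schur's test\<close>

text \<open>
  By Jensen's inequality \<open>\<bar>T x\<bar>\<^sup>r \<le> A\<^sup>r\<^sup>-\<^sup>1 \<integral> k(x, y) \<bar>f y\<bar>\<^sup>r dy\<close>; integrating in \<open>x\<close> and exchanging the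
  integrals produces the missing factor \<open>A\<close> from the column integrals. For \<open>p = \<infinity>\<close> the row integrals
  give the bound directly. Only a pointwise bound relates \<open>T\<close> to the kernel, so \<open>T\<close> may be
  given by an integral that converges merely almost everywhere.
\<close>

lemma Schur_test:
  fixes k :: "'a::euclidean_space \<Rightarrow> 'a \<Rightarrow> real" and f :: "'a \<Rightarrow> real"
  assumes k[measurable]: "(\<lambda>(x, y). k x y) \<in> borel_measurable (borel \<Otimes>\<^sub>M borel)"
    and f[measurable]: "f \<in> borel_measurable borel"
    and k0: "\<And>x y. 0 \<le> k x y" and A: "0 < A" and p: "1 \<le> p"
    and rows: "\<And>x. (\<integral>\<^sup>+ y. ennreal (k x y) \<partial>lborel) \<le> ennreal A"
    and cols: "\<And>y. (\<integral>\<^sup>+ x. ennreal (k x y) \<partial>lborel) \<le> ennreal A"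
    and S: "S \<in> sets lebesgue" and T: "T \<in> borel_measurable (lebesgue_on S)"
    and bound: "AE x in lborel. x \<in> S \<longrightarrow> ennreal \<bar>T x\<bar> \<le> (\<integral>\<^sup>+ y. ennreal (k x y * \<bar>f y\<bar>) \<partial>lborel)"
  shows "Lp_norm p S T \<le> ennreal A * Lp_norm p UNIV f"
proof (cases "Lp_norm p UNIV f")
  case top
  then show ?thesis using A by (simp add: ennreal_mult_top)
next
  case (real a)
  have kx[measurable]: "k x \<in> borel_measurable borel" for x
    by measurable
  have ky[measurable]: "(\<lambda>x. k x y) \<in> borel_measurable borel" for y
    by measurable
  have fU: "f \<in> borel_measurable (lebesgue_on UNIV)"
    by (auto simp: lebesgue_on_UNIV_eq intro: measurable_completion)
  have Aa: "0 \<le> A * a" using A real by simp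
  have "Lp_norm p S T \<le> ennreal (A * a)"
  proof (cases "p = \<infinity>")
    case True
    have "AE y in lborel. \<bar>f y\<bar> \<le> a"
      using Lp_norm_top_le_iff[OF fU, of a] real True by (simp add: AE_lebesgue_on_iff_lborel)
    then have "(\<integral>\<^sup>+ y. ennreal (k x y * \<bar>f y\<bar>) \<partial>lborel) \<le> ennreal (A * a)" for x
    proof -
      assume fa: "AE y in lborel. \<bar>f y\<bar> \<le> a"
      have "(\<integral>\<^sup>+ y. ennreal (k x y * \<bar>f y\<bar>) \<partial>lborel) \<le> (\<integral>\<^sup>+ y. ennreal (k x y) * ennreal a \<partial>lborel)"
        using fa real k0
        by (intro nn_integral_mono_AE)
          (auto elim!: eventually_mono simp flip: ennreal_mult intro!: ennreal_leI mult_left_mono)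
      also have "\<dots> = (\<integral>\<^sup>+ y. ennreal (k x y) \<partial>lborel) * ennreal a"
        by (intro nn_integral_multc) measurable
      also have "\<dots> \<le> ennreal A * ennreal a" using rows by (intro mult_right_mono) auto
      finally show ?thesis using A real by (simp add: ennreal_mult)
    qed
    with bound have "AE x in lborel. x \<in> S \<longrightarrow> \<bar>T x\<bar> \<le> A * a"
      using Aa by (auto elim!: eventually_mono) (meson ennreal_le_iff order_trans)
    then show ?thesis
      using Lp_norm_top_le_iff[OF T Aa] True by (simp add: AE_lebesgue_on_iff_lborel[OF S])
  next
    case False
    define r where "r = enn2real p"
    have r: "1 \<le> r" using enn2real_ge_one[OF p False] by (simp add: r_def)
    have fa: "(\<integral>\<^sup>+ y. ennreal (\<bar>f y\<bar> powr r) \<partial>lborel) \<le> ennreal (a powr r)"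
      using Lp_norm_le_iff[OF p False, of a UNIV f] real
      by (simp add: r_def lebesgue_on_UNIV_eq nn_integral_completion)
    have "(\<integral>\<^sup>+ x. ennreal (\<bar>T x\<bar> powr r) \<partial>lebesgue_on S) =
      (\<integral>\<^sup>+ x. ennreal (\<bar>T x\<bar> powr r) * indicator S x \<partial>lborel)"
      using S by (simp add: nn_integral_restrict_space nn_integral_completion)
    also have "\<dots> \<le> (\<integral>\<^sup>+ x. ennreal (A powr (r - 1)) * (\<integral>\<^sup>+ y. ennreal (k x y * \<bar>f y\<bar> powr r) \<partial>lborel) \<partial>lborel)"
    proof (rule nn_integral_mono_AE, use bound in eventually_elim)
      case (elim x)
      show ?case
      proof (cases "x \<in> S")
        case True
        then have "ennreal (\<bar>T x\<bar> powr r) \<le>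
          ennreal (A powr (r - 1)) * (\<integral>\<^sup>+ y. ennreal (k x y * \<bar>f y\<bar> powr r) \<partial>lborel)"
          using elim by (intro weighted_Jensen_powr k0 r A rows) (auto simp: k0)
        then show ?thesis using True by simp
      qed simp
    qed
    also have "\<dots> = ennreal (A powr (r - 1)) * (\<integral>\<^sup>+ x. (\<integral>\<^sup>+ y. ennreal (k x y * \<bar>f y\<bar> powr r) \<partial>lborel) \<partial>lborel)"
      by (intro nn_integral_cmult) measurable
    also have "(\<integral>\<^sup>+ x. (\<integral>\<^sup>+ y. ennreal (k x y * \<bar>f y\<bar> powr r) \<partial>lborel) \<partial>lborel) =
       (\<integral>\<^sup>+ y. (\<integral>\<^sup>+ x. ennreal (k x y * \<bar>f y\<bar> powr r) \<partial>lborel) \<partial>lborel)"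
      by (rule lborel_pair.Fubini'[symmetric]) measurable
    also have "\<dots> = (\<integral>\<^sup>+ y. (\<integral>\<^sup>+ x. ennreal (k x y) \<partial>lborel) * ennreal (\<bar>f y\<bar> powr r) \<partial>lborel)"
      by (intro nn_integral_cong, subst nn_integral_multc[symmetric]) (auto simp: k0 ennreal_mult)
    also have "\<dots> \<le> (\<integral>\<^sup>+ y. ennreal A * ennreal (\<bar>f y\<bar> powr r) \<partial>lborel)"
      using cols by (intro nn_integral_mono mult_right_mono) auto
    also have "\<dots> = ennreal A * (\<integral>\<^sup>+ y. ennreal (\<bar>f y\<bar> powr r) \<partial>lborel)"
      by (intro nn_integral_cmult) measurable
    also have "\<dots> \<le> ennreal A * ennreal (a powr r)" using fa by (intro mult_left_mono) auto
    finally have "(\<integral>\<^sup>+ x. ennreal (\<bar>T x\<bar> powr r) \<partial>lebesgue_on S) \<le>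
       ennreal (A powr (r - 1)) * (ennreal A * ennreal (a powr r))"
      by (simp add: mult_left_mono)
    also have "\<dots> = ennreal ((A * a) powr r)"
      using A real by (simp add: powr_diff powr_mult flip: ennreal_mult)
    finally show ?thesis unfolding Lp_norm_le_iff[OF p False Aa] r_def .
  qed
  then show ?thesis using real A by (simp add: ennreal_mult)
qed

section \<open>The nonlocal derivative of a mean-free kernel\<close>

text \<open>
  The complement of the essential support is a union of possibly uncountably many open sets on each
  of which \<open>\<mu>\<close> vanishes almost everywhere; by the Lindelof property countably many of them suffice.
  Hence \<open>\<mu>\<close> vanishes almost everywhere off the ball, and a representative may be cut off there.
  It is chosen Borel because the composition of a merely Lebesgue measurable function with
  \<open>(x, y) \<mapsto> y - x\<close> need not be measurable for the product of the two sigma-algebras, as Fubini's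
  theorem requires.
\<close>

lemma kernel_borel_representative:
  fixes \<mu> :: "'a::euclidean_space \<Rightarrow> real"
  assumes \<mu>: "integrable lebesgue \<mu>" and supp: "ess_support \<mu> \<subseteq> cball 0 \<delta>"
  obtains g where "integrable lborel g" "AE z in lborel. \<mu> z = g z" "\<And>z. z \<notin> cball 0 \<delta> \<Longrightarrow> g z = 0"
proof -
  have "\<mu> \<in> borel_measurable lebesgue" using \<mu> by auto
  then obtain g' where g'[measurable]: "g' \<in> borel_measurable borel" and ae: "AE z in lborel. \<mu> z = g' z"
    using completion_ex_borel_measurable_real[of \<mu> lborel] by auto
  define F where "F = {U. open U \<and> (AE x in lebesgue. x \<in> U \<longrightarrow> \<mu> x = 0)}"
  obtain F' where F': "F' \<subseteq> F" "countable F'" "\<Union>F' = \<Union>F"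
    using Lindelof[of F] by (auto simp: F_def)
  have "AE z in lebesgue. \<forall>U\<in>F'. z \<in> U \<longrightarrow> \<mu> z = 0"
    using F'(1) by (subst AE_ball_countable[OF F'(2)]) (auto simp: F_def)
  moreover have "- cball 0 \<delta> \<subseteq> \<Union>F'" using supp by (auto simp: ess_support_def F_def F'(3))
  ultimately have "AE z in lebesgue. z \<notin> cball 0 \<delta> \<longrightarrow> \<mu> z = 0"
    by (auto elim!: eventually_mono)
  then have out: "AE z in lborel. z \<notin> cball 0 \<delta> \<longrightarrow> \<mu> z = 0" by (simp only: AE_completion_iff)
  have [measurable]: "cball (0::'a) \<delta> \<in> sets borel" by auto
  define g where "g z = indicator (cball 0 \<delta>) z * g' z" for z
  have [measurable]: "g \<in> borel_measurable borel" unfolding g_def by measurable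
  have eq: "AE z in lborel. \<mu> z = g z"
    using ae out by eventually_elim (auto simp: g_def indicator_def)
  have "integrable lebesgue g"
  proof (rule integrable_cong_AE_imp[OF \<mu>])
    show "g \<in> borel_measurable lebesgue" by (auto intro: measurable_completion)
    show "AE z in lebesgue. \<mu> z = g z" by (rule AE_completion[OF eq])
  qed
  then have "integrable lborel g" by (simp add: integrable_completion)
  with eq that show ?thesis by (auto simp: g_def)
qed

text \<open>
  On a set of finite measure \<open>\<bar>u\<bar> \<le> 1 + \<bar>u\<bar>\<^sup>r\<close> embeds \<open>L\<^sup>p\<close> into \<open>L\<^sup>1\<close>.
\<close>

lemma Lp_space_integrable:
  assumes u: "u \<in> Lp_space p S" and S: "S \<in> lmeasurable" and p: "1 \<le> p"
  shows "integrable (lebesgue_on S) u"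
proof -
  have S': "S \<in> sets lebesgue" using S by blast
  have fin: "finite_measure (lebesgue_on S)"
    using S by (rule finite_measure_lebesgue_on)
  interpret finite_measure "lebesgue_on S" by (rule fin)
  have um[measurable]: "u \<in> borel_measurable (lebesgue_on S)" using u by (simp add: Lp_space_def)
  obtain a where a: "Lp_norm p S u \<le> ennreal a" "0 \<le> a"
    using u by (cases "Lp_norm p S u") (auto simp: Lp_space_def)
  show ?thesis
  proof (cases "p = \<infinity>")
    case True
    then show ?thesis using a um Lp_norm_top_le_iff[OF um a(2)]
      by (intro integrable_const_bound[where B=a]) auto
  next
    case False
    define r where "r = enn2real p"
    have r: "1 \<le> r" using enn2real_ge_one[OF p False] by (simp add: r_def)
    have I: "(\<integral>\<^sup>+ x. ennreal (\<bar>u x\<bar> powr r) \<partial>lebesgue_on S) \<le> ennreal (a powr r)"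
      using Lp_norm_le_iff[OF p False a(2), of S u] a by (simp add: r_def)
    have "integrable (lebesgue_on S) (\<lambda>x. \<bar>u x\<bar> powr r)"
      using I by (intro integrableI_bounded) (auto simp: le_less_trans)
    then have i: "integrable (lebesgue_on S) (\<lambda>x. 1 + \<bar>u x\<bar> powr r)" by simp
    show ?thesis
    proof (rule Bochner_Integration.integrable_bound[OF i um], rule AE_I2)
      fix x
      have "\<bar>u x\<bar> \<le> 1 + \<bar>u x\<bar> powr r"
      proof (cases "\<bar>u x\<bar> \<le> 1")
        case False
        then have "\<bar>u x\<bar> powr 1 \<le> \<bar>u x\<bar> powr r" using r by (intro powr_mono) auto
        then show ?thesis using False by simp
      qed (simp add: add_increasing2)
      then show "norm (u x) \<le> norm (1 + \<bar>u x\<bar> powr r)" by simp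
    qed
  qed
qed

text \<open>
  The values of \<open>u\<close> off \<open>S\<close> are arbitrary; the representative \<open>v\<close> replaces them by \<open>0\<close>, so that its
  integrals may be taken over the whole space.
\<close>

lemma Lp_space_borel_representative:
  assumes u: "u \<in> Lp_space p S" and S: "open S" "bounded S" and p: "1 \<le> p"
  obtains v where "integrable lborel v" "AE y in lborel. y \<in> S \<longrightarrow> u y = v y"
    "\<And>y. y \<notin> S \<Longrightarrow> v y = 0" "Lp_norm p UNIV v = Lp_norm p S u"
proof -
  have [measurable]: "S \<in> sets borel" using S by auto
  have lm: "S \<in> lmeasurable" using S by (simp add: lmeasurable_open)
  then have S': "S \<in> sets lebesgue" by blast
  have um: "u \<in> borel_measurable (lebesgue_on S)" using u by (simp add: Lp_space_def)
  then have "(\<lambda>x. if x \<in> S then u x else 0) \<in> borel_measurable lebesgue"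
    by (rule borel_measurable_if_I[OF _ S'])
  then obtain v' where v'[measurable]: "v' \<in> borel_measurable borel"
    and ae: "AE y in lborel. (if y \<in> S then u y else 0) = v' y"
    using completion_ex_borel_measurable_real[of "\<lambda>x. if x \<in> S then u x else 0" lborel] by auto
  define v where "v y = indicator S y * v' y" for y
  have vm[measurable]: "v \<in> borel_measurable borel" unfolding v_def by measurable
  have eq: "AE y in lborel. y \<in> S \<longrightarrow> u y = v y"
    using ae by eventually_elim (auto simp: v_def)
  have out: "v y = 0" if "y \<notin> S" for y using that by (simp add: v_def)
  have vU: "v \<in> borel_measurable (lebesgue_on UNIV)"
    by (auto simp: lebesgue_on_UNIV_eq intro: measurable_completion)
  have vS: "v \<in> borel_measurable (lebesgue_on S)"
    by (rule measurable_restrict_mono[OF vU]) simp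
  have "Lp_norm p UNIV v = Lp_norm p S v"
    using S' p vU by (intro Lp_norm_extend_zero) (auto simp: AE_restrict_space_iff out intro!: AE_I2)
  also have "\<dots> = Lp_norm p S u"
    using eq by (intro Lp_norm_cong_AE vS um)
      (auto simp: AE_lebesgue_on_iff_lborel[OF S'] elim!: eventually_mono)
  finally have norm: "Lp_norm p UNIV v = Lp_norm p S u" .
  have "integrable (lebesgue_on S) u" by (rule Lp_space_integrable[OF u lm p])
  then have "integrable lebesgue (\<lambda>x. if x \<in> S then u x else 0)"
    using S' by (simp only: Lebesgue_Measure.integrable_restrict_UNIV)
  then have "integrable lebesgue v"
  proof (rule integrable_cong_AE_imp)
    show "v \<in> borel_measurable lebesgue" by (auto intro: measurable_completion)
    show "AE y in lebesgue. (if y \<in> S then u y else 0) = v y"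
      using AE_completion[OF eq] by eventually_elim (simp add: out)
  qed
  then have "integrable lborel v" by (simp add: integrable_completion)
  from that[OF this eq out norm] show ?thesis .
qed

lemma convolution_integrable_AE:
  fixes f g :: "'a::euclidean_space \<Rightarrow> real"
  assumes f: "integrable lborel f" and g: "integrable lborel g"
  shows "AE x in lborel. integrable lborel (\<lambda>y. f y * g (y - x))"
proof -
  have [measurable]: "f \<in> borel_measurable borel" "g \<in> borel_measurable borel" using f g by auto
  have "(\<integral>\<^sup>+ x. (\<integral>\<^sup>+ y. ennreal \<bar>f y * g (y - x)\<bar> \<partial>lborel) \<partial>lborel) =
        (\<integral>\<^sup>+ y. (\<integral>\<^sup>+ x. ennreal \<bar>f y * g (y - x)\<bar> \<partial>lborel) \<partial>lborel)"
    by (rule lborel_pair.Fubini'[symmetric]) measurable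
  also have "\<dots> = (\<integral>\<^sup>+ y. ennreal \<bar>f y\<bar> * (\<integral>\<^sup>+ z. ennreal \<bar>g z\<bar> \<partial>lborel) \<partial>lborel)"
  proof (rule nn_integral_cong)
    fix y
    have "(\<integral>\<^sup>+ x. ennreal \<bar>f y * g (y - x)\<bar> \<partial>lborel) = ennreal \<bar>f y\<bar> * (\<integral>\<^sup>+ x. ennreal \<bar>g (y - x)\<bar> \<partial>lborel)"
      by (subst nn_integral_cmult[symmetric]) (auto simp: abs_mult ennreal_mult)
    also have "(\<integral>\<^sup>+ x. ennreal \<bar>g (y - x)\<bar> \<partial>lborel) = (\<integral>\<^sup>+ z. ennreal \<bar>g z\<bar> \<partial>lborel)"
      by (rule nn_integral_lborel_reflect) simp
    finally show "(\<integral>\<^sup>+ x. ennreal \<bar>f y * g (y - x)\<bar> \<partial>lborel) =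
      ennreal \<bar>f y\<bar> * (\<integral>\<^sup>+ z. ennreal \<bar>g z\<bar> \<partial>lborel)" .
  qed
  also have "\<dots> = (\<integral>\<^sup>+ y. ennreal \<bar>f y\<bar> \<partial>lborel) * (\<integral>\<^sup>+ z. ennreal \<bar>g z\<bar> \<partial>lborel)"
    by (rule nn_integral_multc) measurable
  also have "\<dots> < \<infinity>"
    using f g by (simp add: integrable_iff_bounded ennreal_mult_less_top)
  finally have "AE x in lborel. (\<integral>\<^sup>+ y. ennreal \<bar>f y * g (y - x)\<bar> \<partial>lborel) \<noteq> \<infinity>"
    by (intro nn_integral_PInf_AE) auto
  then show ?thesis
    by eventually_elim (auto simp: integrable_iff_bounded less_top)
qed

text \<open>
  The term \<open>u(x) \<integral> \<mu>\<close> drops out because \<open>\<mu>\<close> is mean-free. In the remaining integral \<open>u\<close> is only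
  evaluated on the ball around \<open>x\<close>, hence inside \<open>E\<close>, where \<open>v\<close> represents it.
\<close>

lemma nonlocal_deriv_eq_convolution:
  fixes \<mu> u g v :: "'a::euclidean_space \<Rightarrow> real"
  assumes g: "integrable lborel g" "AE z in lborel. \<mu> z = g z" "\<And>z. z \<notin> cball 0 \<delta> \<Longrightarrow> g z = 0"
    and mf: "mean_free \<mu>"
    and v: "v \<in> borel_measurable borel" "AE y in lborel. y \<in> E \<longrightarrow> u y = v y"
    and x: "cball x \<delta> \<subseteq> E" and int: "integrable lborel (\<lambda>y. v y * g (y - x))"
  shows "nonlocal_deriv \<mu> u x = (\<integral> y. v y * g (y - x) \<partial>lborel)"
proof -
  have [measurable]: "g \<in> borel_measurable borel" "v \<in> borel_measurable borel" using g v by auto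
  have gm: "g \<in> borel_measurable lebesgue" by (auto intro: measurable_completion)
  have "(\<integral>z. g z \<partial>lebesgue) = (\<integral>z. \<mu> z \<partial>lebesgue)"
  proof (rule integral_cong_AE)
    have ae: "AE z in lebesgue. g z = \<mu> z" using AE_completion[OF g(2)] by (auto elim!: eventually_mono)
    then show "AE z in lebesgue. g z = \<mu> z" .
    show "\<mu> \<in> borel_measurable lebesgue" by (rule borel_measurable_AE[OF gm ae])
  qed (rule gm)
  then have g0: "(\<integral>z. g z \<partial>lborel) = 0"
    using mf by (simp add: mean_free_def integral_completion)
  have ae: "AE z in lborel. (v (x + z) - u x) * g z = (u (x + z) - u x) * \<mu> z"
    using g(2) AE_lborel_translate[OF v(2), of x]
  proof eventually_elim
    case (elim z)
    show ?case
    proof (cases "z \<in> cball 0 \<delta>")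
      case True
      then have "x + z \<in> E" using x by (auto simp: dist_norm)
      then show ?thesis using elim by simp
    next
      case False
      then show ?thesis using elim g(3) by simp
    qed
  qed
  have m: "(\<lambda>z. (v (x + z) - u x) * g z) \<in> borel_measurable lborel" by measurable
  have "nonlocal_deriv \<mu> u x = (\<integral>z. (v (x + z) - u x) * g z \<partial>lebesgue)"
    unfolding nonlocal_deriv_def
  proof (rule integral_cong_AE[symmetric])
    show m': "(\<lambda>z. (v (x + z) - u x) * g z) \<in> borel_measurable lebesgue"
      using m by (rule measurable_completion)
    show ae': "AE z in lebesgue. (v (x + z) - u x) * g z = (u (x + z) - u x) * \<mu> z"
      by (rule AE_completion[OF ae])
    show "(\<lambda>z. (u (x + z) - u x) * \<mu> z) \<in> borel_measurable lebesgue"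
      by (rule borel_measurable_AE[OF m' ae'])
  qed
  also have "\<dots> = (\<integral>z. (v (x + z) - u x) * g z \<partial>lborel)"
    using m by (rule integral_completion)
  also have "\<dots> = (\<integral>z. v (x + z) * g z - u x * g z \<partial>lborel)" by (simp add: algebra_simps)
  also have "\<dots> = (\<integral>z. v (x + z) * g z \<partial>lborel) - (\<integral>z. u x * g z \<partial>lborel)"
  proof (rule Bochner_Integration.integral_diff)
    have "integrable (distr lborel borel ((+) x)) (\<lambda>y. v y * g (y - x))"
      using int unfolding lborel_distr_plus .
    then show "integrable lborel (\<lambda>z. v (x + z) * g z)"
      by (subst (asm) integrable_distr_eq) auto
  qed (use g(1) in simp)
  also have "\<dots> = (\<integral>z. v (x + z) * g z \<partial>lborel)" by (simp add: g0)
  also have "\<dots> = (\<integral>y. v y * g (y - x) \<partial>lborel)"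
    using integral_lborel_translate[of "\<lambda>z. v (x + z) * g z" x] by simp
  finally show ?thesis .
qed

lemma nonlocal_deriv_borel_measurable:
  fixes \<mu> u :: "'a::euclidean_space \<Rightarrow> real"
  assumes \<mu>: "integrable lebesgue \<mu>" "ess_support \<mu> \<subseteq> cball 0 \<delta>" "mean_free \<mu>"
    and S: "S \<in> sets lebesgue" and E: "open E" "bounded E" "\<And>x. x \<in> S \<Longrightarrow> cball x \<delta> \<subseteq> E"
    and p: "1 \<le> p" and u: "u \<in> Lp_space p E"
  shows "nonlocal_deriv \<mu> u \<in> borel_measurable (lebesgue_on S)"
proof -
  obtain g where g: "integrable lborel g" "AE z in lborel. \<mu> z = g z" "\<And>z. z \<notin> cball 0 \<delta> \<Longrightarrow> g z = 0"
    using kernel_borel_representative[OF \<mu>(1,2)] by blast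
  obtain v where v: "integrable lborel v" "AE y in lborel. y \<in> E \<longrightarrow> u y = v y"
    using Lp_space_borel_representative[OF u E(1,2) p] by blast
  have [measurable]: "g \<in> borel_measurable borel" "v \<in> borel_measurable borel" using g v by auto
  define c where "c x = (\<integral> y. v y * g (y - x) \<partial>lborel)" for x
  have "c \<in> borel_measurable borel" unfolding c_def by measurable
  then have c: "(\<lambda>x. if x \<in> S then c x else 0) \<in> borel_measurable lebesgue"
    using S by (intro measurable_If_set) (auto intro: measurable_completion)
  have "AE x in lborel. (if x \<in> S then c x else 0) = (if x \<in> S then nonlocal_deriv \<mu> u x else 0)"
    using convolution_integrable_AE[OF v(1) g(1)]
  proof eventually_elim
    case (elim x)
    show ?case
      using nonlocal_deriv_eq_convolution[OF g \<mu>(3) _ v(2) E(3) elim] by (simp add: c_def)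
  qed
  then have "(\<lambda>x. if x \<in> S then nonlocal_deriv \<mu> u x else 0) \<in> borel_measurable lebesgue"
    by (rule borel_measurable_AE[OF c AE_completion])
  then show ?thesis by (rule borel_measurable_if_D)
qed

text \<open>
  With \<open>h\<close> and \<open>q\<close> from the discretisation of the kernel, the functionals are
  \<open>u \<mapsto> \<integral> u(y) h(y - c) dy\<close> for the finitely many values \<open>c\<close> of \<open>q\<close>. Where they vanish, the nonlocal
  derivative coincides with the integral operator whose kernel is the discretisation error.
\<close>

theorem nonlocal_deriv_finite_rank_approximable:
  fixes \<mu> :: "'a::euclidean_space \<Rightarrow> real"
  assumes \<mu>: "integrable lebesgue \<mu>" "ess_support \<mu> \<subseteq> cball 0 \<delta>" "mean_free \<mu>"
    and S: "open S" "bounded S" and E: "open E" "bounded E" "\<And>x. x \<in> S \<Longrightarrow> cball x \<delta> \<subseteq> E"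
    and p: "1 \<le> p"
  shows "finite_rank_approximable (Lp_space p E) (Lp_norm p E) (Lp_norm p S) (nonlocal_deriv \<mu>)"
  unfolding finite_rank_approximable_def
proof (intro allI impI)
  fix \<epsilon> :: real assume \<epsilon>: "\<epsilon> > 0"
  obtain g where g: "integrable lborel g" "AE z in lborel. \<mu> z = g z" "\<And>z. z \<notin> cball 0 \<delta> \<Longrightarrow> g z = 0"
    using kernel_borel_representative[OF \<mu>(1,2)] by blast
  have [measurable]: "g \<in> borel_measurable borel" using g by auto
  have [measurable]: "S \<in> sets borel" "E \<in> sets borel" using S E by auto
  have Sl: "S \<in> sets lebesgue" and El: "E \<in> sets lebesgue" using S E by auto
  have Em: "E \<in> lmeasurable" using E by (simp add: lmeasurable_open)
  obtain h q where h: "continuous_on UNIV h" and q: "q \<in> borel_measurable borel" "finite (range q)"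
    and rows: "\<And>x. (\<integral>\<^sup>+ y. ennreal (indicator S x * indicator E y * \<bar>g (y - x) - h (y - q x)\<bar>) \<partial>lborel) \<le> ennreal \<epsilon>"
    and cols: "\<And>y. (\<integral>\<^sup>+ x. ennreal (indicator S x * indicator E y * \<bar>g (y - x) - h (y - q x)\<bar>) \<partial>lborel) \<le> ennreal \<epsilon>"
    using kernel_discretisation[OF g(1) S E(1,2) \<epsilon>]
    by (elim exE conjE) (rule that; (assumption | erule spec))
  note [measurable] = q(1)
  have hm[measurable]: "h \<in> borel_measurable borel" using h by (rule borel_measurable_continuous_onI)
  have hc: "\<exists>B. \<forall>y\<in>E. \<bar>h (y - c)\<bar> \<le> B" for c
  proof -
    have "compact ((\<lambda>y. h (y - c)) ` closure E)"
      using E(2) by (intro compact_continuous_image continuous_on_compose2[OF h] continuous_intros) auto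
    then have "bounded ((\<lambda>y. h (y - c)) ` closure E)" by (rule compact_imp_bounded)
    then obtain B where "\<forall>y\<in>closure E. \<bar>h (y - c)\<bar> \<le> B"
      unfolding bounded_iff by auto
    then show ?thesis using closure_subset[of E] by (intro exI[of _ B]) auto
  qed
  define l where "l c u = (\<integral> y. u y * h (y - c) \<partial>lebesgue_on E)" for c and u :: "'a \<Rightarrow> real"
  have int: "integrable (lebesgue_on E) (\<lambda>y. u y * h (y - c))" if u: "u \<in> Lp_space p E" for u c
  proof -
    obtain B where B: "\<And>y. y \<in> E \<Longrightarrow> \<bar>h (y - c)\<bar> \<le> B" using hc by blast
    have ui: "integrable (lebesgue_on E) u" by (rule Lp_space_integrable[OF u Em p])
    have "integrable (lebesgue_on E) (\<lambda>y. u y * B)" using ui by simp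
    then show ?thesis
    proof (rule Bochner_Integration.integrable_bound)
      have "(\<lambda>y. h (y - c)) \<in> borel_measurable lborel" by measurable
      then have "(\<lambda>y. h (y - c)) \<in> borel_measurable (lebesgue_on E)"
        by (intro measurable_restrict_space1 measurable_completion)
      then show "(\<lambda>y. u y * h (y - c)) \<in> borel_measurable (lebesgue_on E)"
        using ui by auto
      show "AE y in lebesgue_on E. norm (u y * h (y - c)) \<le> norm (u y * B)"
      proof (rule AE_I2)
        fix y assume "y \<in> space (lebesgue_on E)"
        then have "\<bar>h (y - c)\<bar> \<le> \<bar>B\<bar>" using B[of y] by auto
        then show "norm (u y * h (y - c)) \<le> norm (u y * B)"
          by (simp add: abs_mult mult_left_mono)
      qed
    qed
  qed
  have lin: "linear_functional_on (Lp_space p E) (l c)" for c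
    unfolding linear_functional_on_def
  proof (intro conjI ballI allI)
    fix u v assume "u \<in> Lp_space p E" "v \<in> Lp_space p E"
    then show "l c (u + v) = l c u + l c v"
      using int[of u c] int[of v c] unfolding l_def by (simp add: distrib_right)
  next
    fix u and a :: real assume "u \<in> Lp_space p E"
    then show "l c (a *\<^sub>R u) = a * l c u" unfolding l_def by (simp add: scaleR_fun_def mult.assoc)
  qed
  define k where "k x y = indicator S x * indicator E y * \<bar>g (y - x) - h (y - q x)\<bar>" for x y
  have km: "(\<lambda>(x, y). k x y) \<in> borel_measurable (borel \<Otimes>\<^sub>M borel)"
    unfolding k_def by measurable
  have "Lp_norm p S (nonlocal_deriv \<mu> u) \<le> ennreal \<epsilon> * Lp_norm p E u"
    if u: "u \<in> Lp_space p E" and ker: "\<And>x. l (q x) u = 0" for u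
  proof -
    obtain v where v: "integrable lborel v" "AE y in lborel. y \<in> E \<longrightarrow> u y = v y"
      "\<And>y. y \<notin> E \<Longrightarrow> v y = 0" "Lp_norm p UNIV v = Lp_norm p E u"
      using Lp_space_borel_representative[OF u E(1,2) p] by blast
    have vm[measurable]: "v \<in> borel_measurable borel" using v by auto
    \<comment> \<open>The vanishing functionals make the discretised kernel act as zero.\<close>
    have vh: "integrable lborel (\<lambda>y. v y * h (y - q x)) \<and> (\<integral>y. v y * h (y - q x) \<partial>lborel) = 0" for x
    proof -
      let ?f = "\<lambda>y. if y \<in> E then u y * h (y - q x) else 0"
      have m: "(\<lambda>y. v y * h (y - q x)) \<in> borel_measurable lborel" by measurable
      have i: "integrable lebesgue ?f"
        using int[OF u] El by (simp only: Lebesgue_Measure.integrable_restrict_UNIV)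
      have ae: "AE y in lebesgue. ?f y = v y * h (y - q x)"
        using AE_completion[OF v(2)] by eventually_elim (simp add: v(3))
      have "integrable lebesgue (\<lambda>y. v y * h (y - q x))"
        by (rule integrable_cong_AE_imp[OF i measurable_completion[OF m] ae])
      moreover have "(\<integral>y. v y * h (y - q x) \<partial>lebesgue) = (\<integral>y. ?f y \<partial>lebesgue)"
        using ae by (intro integral_cong_AE measurable_completion[OF m] borel_measurable_integrable[OF i])
          (auto elim!: eventually_mono)
      moreover have "(\<integral>y. ?f y \<partial>lebesgue) = l (q x) u"
        unfolding l_def using El by (simp only: Lebesgue_Measure.integral_restrict_UNIV)
      ultimately show ?thesis
        using m ker[of x] by (simp add: integrable_completion integral_completion)
    qed
    \<comment> \<open>Hence it may be subtracted under the integral that gives the nonlocal derivative.\<close>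
    have "AE x in lborel. x \<in> S \<longrightarrow>
      ennreal \<bar>nonlocal_deriv \<mu> u x\<bar> \<le> (\<integral>\<^sup>+ y. ennreal (k x y * \<bar>v y\<bar>) \<partial>lborel)"
      using convolution_integrable_AE[OF v(1) g(1)]
    proof eventually_elim
      case (elim x)
      show ?case
      proof
        assume x: "x \<in> S"
        have "nonlocal_deriv \<mu> u x = (\<integral> y. v y * g (y - x) \<partial>lborel)"
          by (rule nonlocal_deriv_eq_convolution[OF g \<mu>(3) vm v(2) E(3)[OF x] elim])
        also have "\<dots> = (\<integral> y. v y * g (y - x) - v y * h (y - q x) \<partial>lborel)"
          using elim vh[of x] by simp
        finally have "ennreal \<bar>nonlocal_deriv \<mu> u x\<bar> \<le>
          (\<integral>\<^sup>+ y. ennreal \<bar>v y * g (y - x) - v y * h (y - q x)\<bar> \<partial>lborel)"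
          using integral_norm_bound_ennreal[OF Bochner_Integration.integrable_diff[OF elim vh[THEN conjunct1, of x]]]
          by simp
        also have "\<dots> = (\<integral>\<^sup>+ y. ennreal (k x y * \<bar>v y\<bar>) \<partial>lborel)"
        proof (rule nn_integral_cong)
          fix y
          have "\<bar>v y * g (y - x) - v y * h (y - q x)\<bar> = \<bar>g (y - x) - h (y - q x)\<bar> * \<bar>v y\<bar>"
            by (simp flip: abs_mult add: algebra_simps)
          then show "ennreal \<bar>v y * g (y - x) - v y * h (y - q x)\<bar> = ennreal (k x y * \<bar>v y\<bar>)"
            using x v(3)[of y] by (auto simp: k_def indicator_def)
        qed
        finally show "ennreal \<bar>nonlocal_deriv \<mu> u x\<bar> \<le> (\<integral>\<^sup>+ y. ennreal (k x y * \<bar>v y\<bar>) \<partial>lborel)" .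
      qed
    qed
    then have "Lp_norm p S (nonlocal_deriv \<mu> u) \<le> ennreal \<epsilon> * Lp_norm p UNIV v"
      by (intro Schur_test[OF km vm _ \<epsilon> p _ _ Sl nonlocal_deriv_borel_measurable[OF \<mu> Sl E p u]])
        (use rows cols in \<open>auto simp: k_def\<close>)
    then show ?thesis by (simp add: v(4))
  qed
  then show "\<exists>L. finite L \<and> (\<forall>l\<in>L. linear_functional_on (Lp_space p E) l) \<and>
     (\<forall>u\<in>Lp_space p E. (\<forall>l\<in>L. l u = 0) \<longrightarrow> Lp_norm p S (nonlocal_deriv \<mu> u) \<le> ennreal \<epsilon> * Lp_norm p E u)"
    using q(2) lin by (intro exI[of _ "l ` range q"]) auto
qed

section \<open>The enlarged domain and the extended derivative\<close>

text \<open>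
  The enlarged domain is the union of the translates of \<open>\<Omega>\<close> by vectors of norm at most \<open>\<delta>\<close>. This
  makes it open although the balls in its definition are closed.
\<close>

lemma open_enlarged: "open \<Omega> \<Longrightarrow> 0 \<le> \<delta> \<Longrightarrow> open (enlarged \<Omega> \<delta>)"
  and cball_subset_enlarged: "x \<in> \<Omega> \<Longrightarrow> cball x \<delta> \<subseteq> enlarged \<Omega> \<delta>"
  and bounded_enlarged: "bounded \<Omega> \<Longrightarrow> bounded (enlarged \<Omega> \<delta>)"
proof -
  have eq: "enlarged \<Omega> \<delta> = (\<Union>z\<in>cball 0 \<delta>. (+) z ` \<Omega>) \<union> \<Omega>"
  proof -
    have "y \<in> (\<Union>x\<in>\<Omega>. cball x \<delta>) \<longleftrightarrow> y \<in> (\<Union>z\<in>cball 0 \<delta>. (+) z ` \<Omega>)" for y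
    proof
      assume "y \<in> (\<Union>x\<in>\<Omega>. cball x \<delta>)"
      then obtain x where "x \<in> \<Omega>" "dist x y \<le> \<delta>" by auto
      then show "y \<in> (\<Union>z\<in>cball 0 \<delta>. (+) z ` \<Omega>)"
        by (intro UN_I[of "y - x"] image_eqI[of _ _ x]) (auto simp: dist_norm norm_minus_commute)
    next
      assume "y \<in> (\<Union>z\<in>cball 0 \<delta>. (+) z ` \<Omega>)"
      then show "y \<in> (\<Union>x\<in>\<Omega>. cball x \<delta>)" by (auto simp: dist_norm intro!: bexI)
    qed
    then show ?thesis unfolding enlarged_def collar_def by blast
  qed
  show "open (enlarged \<Omega> \<delta>)" if "open \<Omega>"
    unfolding eq using that by (intro open_Un open_UN ballI open_translation) auto
  show "cball x \<delta> \<subseteq> enlarged \<Omega> \<delta>" if "x \<in> \<Omega>" using that by (auto simp: enlarged_def collar_def)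
  show "bounded (enlarged \<Omega> \<delta>)" if b: "bounded \<Omega>"
  proof -
    obtain R where R: "\<And>x. x \<in> \<Omega> \<Longrightarrow> norm x \<le> R" using b unfolding bounded_iff by auto
    have "norm y \<le> R + \<bar>\<delta>\<bar>" if "y \<in> enlarged \<Omega> \<delta>" for y
    proof -
      from that consider (a) "y \<in> \<Omega>" | (b) z x where "x \<in> \<Omega>" "norm z \<le> \<delta>" "y = z + x"
        unfolding eq by auto
      then show ?thesis
      proof cases
        case a
        then show ?thesis using R[of y] by linarith
      next
        case b
        then show ?thesis using R[of x] norm_triangle_ineq[of z x] by auto
      qed
    qed
    then show ?thesis unfolding bounded_iff by blast
  qed
qed

lemma subset_enlarged: "\<Omega> \<subseteq> enlarged \<Omega> \<delta>"
  and enlarged_diff: "enlarged \<Omega> \<delta> - \<Omega> = collar \<Omega> \<delta>"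
  by (auto simp: enlarged_def collar_def)

lemma ext_nonlocal_deriv_measurable_and_norm:
  fixes \<mu> u :: "'a::euclidean_space \<Rightarrow> real"
  assumes \<mu>: "integrable lebesgue \<mu>" "ess_support \<mu> \<subseteq> cball 0 \<delta>" "mean_free \<mu>"
    and \<Omega>: "open \<Omega>" "bounded \<Omega>" and \<delta>: "0 \<le> \<delta>" and p: "1 \<le> p" and u: "u \<in> Lp_space p (enlarged \<Omega> \<delta>)"
  shows "ext_nonlocal_deriv \<Omega> \<mu> u \<in> borel_measurable (lebesgue_on (enlarged \<Omega> \<delta>))"
    and "Lp_norm p (enlarged \<Omega> \<delta>) (ext_nonlocal_deriv \<Omega> \<mu> u) = Lp_norm p \<Omega> (nonlocal_deriv \<mu> u)"
proof -
  let ?E = "enlarged \<Omega> \<delta>"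
  have Ol: "\<Omega> \<in> sets lebesgue" and El: "?E \<in> sets lebesgue"
    using \<Omega> \<delta> open_enlarged[of \<Omega> \<delta>] by auto
  have m: "nonlocal_deriv \<mu> u \<in> borel_measurable (lebesgue_on \<Omega>)"
    by (rule nonlocal_deriv_borel_measurable[OF \<mu> Ol open_enlarged[OF \<Omega>(1) \<delta>] bounded_enlarged[OF \<Omega>(2)]
      cball_subset_enlarged p u])
  have "(\<lambda>x. if x \<in> \<Omega> then nonlocal_deriv \<mu> u x else 0) \<in> borel_measurable lebesgue"
    by (rule borel_measurable_if_I[OF m Ol])
  then have "ext_nonlocal_deriv \<Omega> \<mu> u \<in> borel_measurable lebesgue"
    unfolding ext_nonlocal_deriv_def[abs_def] .
  then show me: "ext_nonlocal_deriv \<Omega> \<mu> u \<in> borel_measurable (lebesgue_on ?E)"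
    by (rule measurable_restrict_space1)
  have m\<Omega>: "ext_nonlocal_deriv \<Omega> \<mu> u \<in> borel_measurable (lebesgue_on \<Omega>)"
    by (rule measurable_restrict_mono[OF me subset_enlarged])
  have "Lp_norm p ?E (ext_nonlocal_deriv \<Omega> \<mu> u) = Lp_norm p \<Omega> (ext_nonlocal_deriv \<Omega> \<mu> u)"
    using Ol El p me subset_enlarged
    by (intro Lp_norm_extend_zero) (auto simp: ext_nonlocal_deriv_def intro!: AE_I2)
  also have "\<dots> = Lp_norm p \<Omega> (nonlocal_deriv \<mu> u)"
    by (rule Lp_norm_cong_AE[OF m\<Omega> m]) (auto simp: ext_nonlocal_deriv_def intro!: AE_I2)
  finally show "Lp_norm p ?E (ext_nonlocal_deriv \<Omega> \<mu> u) = Lp_norm p \<Omega> (nonlocal_deriv \<mu> u)" .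
qed

lemma ext_nonlocal_deriv_finite_rank_approximable:
  fixes \<mu> :: "'a::euclidean_space \<Rightarrow> real"
  assumes \<mu>: "integrable lebesgue \<mu>" "ess_support \<mu> \<subseteq> cball 0 \<delta>" "mean_free \<mu>"
    and \<Omega>: "open \<Omega>" "bounded \<Omega>" and \<delta>: "0 \<le> \<delta>" and p: "1 \<le> p"
  shows "finite_rank_approximable (Lp_space p (enlarged \<Omega> \<delta>)) (Lp_norm p (enlarged \<Omega> \<delta>))
    (Lp_norm p (enlarged \<Omega> \<delta>)) (ext_nonlocal_deriv \<Omega> \<mu>)"
  using nonlocal_deriv_finite_rank_approximable[OF \<mu> \<Omega> open_enlarged[OF \<Omega>(1) \<delta>] bounded_enlarged[OF \<Omega>(2)]
      cball_subset_enlarged p]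
    ext_nonlocal_deriv_measurable_and_norm(2)[OF assms]
  unfolding finite_rank_approximable_def by simp

section \<open>Failure of the Poincare inequality\<close>

text \<open>
  If finitely many vectors \<open>B\<close> spanned \<open>X\<close> up to null vectors, each \<open>f i\<close> would have a
  representative \<open>v i\<close> in the span of \<open>B\<close>. The premise makes every such choice of
  representatives linearly independent and thus injective, so that the span of \<open>B\<close> would contain
  infinitely many independent vectors.
\<close>

lemma infinite_dimensionalI:
  fixes f :: "nat \<Rightarrow> 'v::real_vector"
  assumes X: "subspace X" and f: "\<And>i. f i \<in> X"
    and indep: "\<And>I a v i. finite I \<Longrightarrow> (\<And>i. v i \<in> X) \<Longrightarrow> (\<And>i. N (f i - v i) = 0) \<Longrightarrow>
      (\<Sum>i\<in>I. a i *\<^sub>R v i) = 0 \<Longrightarrow> i \<in> I \<Longrightarrow> a i = (0::real)"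
  shows "infinite_dimensional N X"
  unfolding infinite_dimensional_def
proof
  assume "\<exists>B. finite B \<and> B \<subseteq> X \<and> (\<forall>u\<in>X. \<exists>v\<in>span B. N (u - v) = 0)"
  then obtain B where B: "finite B" "B \<subseteq> X" "\<And>u. u \<in> X \<Longrightarrow> \<exists>v\<in>span B. N (u - v) = 0" by blast
  then have "\<forall>i. \<exists>v. v \<in> span B \<and> N (f i - v) = 0" using f by blast
  then obtain v where v: "\<And>i. v i \<in> span B" "\<And>i. N (f i - v i) = 0" by metis
  have vX: "v i \<in> X" for i using v(1) B(2) X span_minimal by blast
  have inj: "inj v"
  proof (rule injI, rule ccontr)
    fix i j assume ij: "v i = v j" "i \<noteq> j"
    have "(\<Sum>k\<in>{i, j}. (if k = i then 1 else -1) *\<^sub>R v k) = 0" using ij by simp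
    from indep[OF _ vX v(2) this, of i] show False by simp
  qed
  have "independent (range v)"
    unfolding independent_explicit_module
  proof (intro allI impI)
    fix t :: "'v set" and u w assume t: "finite t" "t \<subseteq> range v" "(\<Sum>w\<in>t. u w *\<^sub>R w) = 0" "w \<in> t"
    define I where "I = v -` t"
    have tI: "t = v ` I" using t(2) by (auto simp: I_def)
    have "finite I" unfolding I_def using t(1) inj by (rule finite_vimageI)
    moreover have "(\<Sum>i\<in>I. u (v i) *\<^sub>R v i) = 0"
      using t(3) inj unfolding tI by (subst (asm) sum.reindex) (auto intro: inj_on_subset)
    ultimately have "u (v i) = 0" if "i \<in> I" for i
      using indep[OF _ vX v(2), of I "\<lambda>i. u (v i)" i] that by blast
    then show "u w = 0" using t(4) tI by blast
  qed
  moreover have "range v \<subseteq> span B" using v(1) by blast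
  ultimately have "finite (range v)" using independent_span_bound[OF B(1)] by blast
  then show False using inj finite_imageD by blast
qed

text \<open>
  The indicator functions of disjoint open subsets \<open>A i\<close> of \<open>\<Omega>\<close> are linearly independent even modulo
  null functions. Concentric annuli in a ball inside \<open>\<Omega>\<close> are a convenient choice of the \<open>A i\<close>.
\<close>

lemma infinite_dimensional_Lp0_space:
  fixes \<Omega> :: "'a::euclidean_space set"
  assumes \<Omega>: "\<Omega> \<noteq> {}" "open \<Omega>" "bounded \<Omega>" and \<delta>: "0 \<le> \<delta>" and p: "1 \<le> p"
    and X: "subspace (Lp0_space p \<Omega> \<delta>)"
  shows "infinite_dimensional (Lp_norm p \<Omega>) (Lp0_space p \<Omega> \<delta>)"
proof -
  let ?E = "enlarged \<Omega> \<delta>"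
  have Ol: "\<Omega> \<in> sets lebesgue" and El: "?E \<in> sets lebesgue"
    using \<Omega> \<delta> open_enlarged[of \<Omega> \<delta>] by auto
  have Em: "?E \<in> lmeasurable"
    using open_enlarged[OF \<Omega>(2) \<delta>] bounded_enlarged[OF \<Omega>(3)] by (simp add: lmeasurable_open)
  obtain x0 e where e: "0 < e" "ball x0 e \<subseteq> \<Omega>" using \<Omega> openE by (metis ex_in_conv)
  define A where "A i = {x. e / (real i + 2) < dist x0 x \<and> dist x0 x < e / (real i + 1)}" for i
  have Ao: "open (A i)" for i
    unfolding A_def by (intro open_Collect_conj open_Collect_less continuous_intros)
  have A\<Omega>: "A i \<subseteq> \<Omega>" for i
  proof
    fix x assume "x \<in> A i"
    then have "dist x0 x < e / (real i + 1)" by (simp add: A_def)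
    also have "\<dots> \<le> e" using e by (simp add: divide_le_eq mult_le_cancel_left1)
    finally show "x \<in> \<Omega>" using e by auto
  qed
  have Ane: "A i \<noteq> {}" for i
  proof -
    obtain b :: 'a where b: "b \<in> Basis" using nonempty_Basis by blast
    obtain t where t: "e / (real i + 2) < t" "t < e / (real i + 1)"
      using dense[of "e / (real i + 2)" "e / (real i + 1)"] e by (auto simp: divide_strict_left_mono)
    moreover have "0 < e / (real i + 2)" using e by simp
    ultimately have "x0 + t *\<^sub>R b \<in> A i" using b by (simp add: A_def dist_norm)
    then show ?thesis by blast
  qed
  have disj: "x \<notin> A j" if ij: "x \<in> A i" "i \<noteq> j" for x i j
  proof -
    have "x \<notin> A j" if "x \<in> A i" "i < j" for x i j
    proof
      assume "x \<in> A j"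
      then have "dist x0 x < e / (real j + 1)" by (simp add: A_def)
      moreover have "e / (real j + 1) \<le> e / (real i + 2)"
        using e that(2) by (intro divide_left_mono) auto
      moreover have "e / (real i + 2) < dist x0 x" using that(1) by (simp add: A_def)
      ultimately show False by linarith
    qed
    with ij show ?thesis by (metis linorder_neqE_nat)
  qed
  define f where "f i = indicat_real (A i)" for i
  have fm: "f i \<in> borel_measurable (lebesgue_on ?E)" for i
    unfolding f_def using Ao by (intro measurable_restrict_space1 measurable_completion) auto
  have "Lp_norm p ?E (f i) < \<infinity>" for i
  proof (cases "p = \<infinity>")
    case True
    have "Lp_norm p ?E (f i) \<le> ennreal 1"
      unfolding True using Lp_norm_top_le_iff[OF fm, of 1 i] by (simp add: f_def indicator_def)
    then show ?thesis by (auto intro: le_less_trans)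
  next
    case False
    have "(\<integral>\<^sup>+ x. ennreal (\<bar>f i x\<bar> powr enn2real p) \<partial>lebesgue_on ?E) \<le> (\<integral>\<^sup>+ x. 1 \<partial>lebesgue_on ?E)"
      using enn2real_ge_one[OF p False] by (intro nn_integral_mono) (auto simp: f_def indicator_def)
    also have "\<dots> < \<infinity>"
      using Em El by (simp add: emeasure_restrict_space fmeasurable_def)
    finally show ?thesis using False by (auto simp: Lp_norm_def Let_def)
  qed
  moreover have "f i x = 0" if "x \<in> collar \<Omega> \<delta>" for i x
    using that A\<Omega>[of i] by (auto simp: f_def indicator_def collar_def)
  ultimately have fX: "f i \<in> Lp0_space p \<Omega> \<delta>" for i
    using fm by (auto simp: Lp0_space_def Lp_space_def intro!: AE_I2)
  show ?thesis
  proof (rule infinite_dimensionalI[where f=f, OF X fX])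
    fix I and a :: "nat \<Rightarrow> real" and v :: "nat \<Rightarrow> 'a \<Rightarrow> real" and j
    assume I: "finite I" and v: "\<And>i. v i \<in> Lp0_space p \<Omega> \<delta>" and N: "\<And>i. Lp_norm p \<Omega> (f i - v i) = 0"
      and sum: "(\<Sum>i\<in>I. a i *\<^sub>R v i) = 0" and j: "j \<in> I"
    have ae: "AE x in lebesgue_on \<Omega>. (f i - v i) x = 0" for i
    proof -
      have "f i - v i \<in> Lp0_space p \<Omega> \<delta>" using fX v X subspace_diff by blast
      then have "f i - v i \<in> borel_measurable (lebesgue_on ?E)" by (simp add: Lp0_space_def Lp_space_def)
      then have "f i - v i \<in> borel_measurable (lebesgue_on \<Omega>)"
        by (rule measurable_restrict_mono[OF _ subset_enlarged])
      then show ?thesis using N Lp_norm_eq_0_iff[OF _ p] by blast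
    qed
    have "AE x in lebesgue_on \<Omega>. \<forall>i\<in>I. (f i - v i) x = 0"
      using I ae by (intro AE_finite_allI) auto
    then have ae2: "AE x in lebesgue. x \<in> \<Omega> \<longrightarrow> (\<forall>i\<in>I. (f i - v i) x = 0)"
      using Ol by (simp add: AE_restrict_space_iff)
    show "a j = 0"
    proof (rule ccontr)
      assume aj: "a j \<noteq> 0"
      \<comment> \<open>On \<open>A j\<close> the vanishing combination of representatives reduces to the constant \<open>a j\<close>, so
        the nonempty open set \<open>A j\<close> would be a null set.\<close>
      have "AE x in lebesgue. x \<in> A j \<longrightarrow> x \<in> {}"
        using ae2
      proof eventually_elim
        case (elim x)
        show ?case
        proof
          assume x: "x \<in> A j"
          have "0 = (\<Sum>i\<in>I. a i *\<^sub>R v i) x" using sum by simp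
          also have "\<dots> = (\<Sum>i\<in>I. a i * v i x)" unfolding sum_fun_apply by (simp add: scaleR_fun_def)
          also have "\<dots> = (\<Sum>i\<in>I. a i * f i x)"
            using elim x A\<Omega>[of j] by (intro sum.cong) auto
          also have "\<dots> = (\<Sum>i\<in>I. if i = j then a j else 0)"
            using x disj[OF x] by (intro sum.cong) (auto simp: f_def indicator_def)
          also have "\<dots> = a j" using I j by simp
          finally show "x \<in> {}" using aj by simp
        qed
      qed
      moreover obtain x where "x \<in> A j" using Ane by blast
      ultimately show False using mem_closed_if_AE_lebesgue_open[OF Ao closed_empty] by blast
    qed
  qed
qed

text \<open>
  On functions that vanish in the collar the norms over \<open>\<Omega>\<close> and over the enlarged domain agree, so
  the approximation property of the nonlocal derivative restricts to this subspace with the norm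
  over \<open>\<Omega>\<close> on both sides.
\<close>

lemma no_poincare_inequality:
  fixes \<nu> :: "'a::euclidean_space \<Rightarrow> real"
  assumes \<nu>: "integrable lebesgue \<nu>" "ess_support \<nu> \<subseteq> cball 0 \<delta>" "mean_free \<nu>"
    and \<Omega>: "\<Omega> \<noteq> {}" "open \<Omega>" "bounded \<Omega>" and \<delta>: "0 \<le> \<delta>" and p: "1 \<le> p"
  shows "\<not> bounded_below_on (Lp_norm p \<Omega>) (Lp_norm p \<Omega>) (nonlocal_deriv \<nu>) (Lp0_space p \<Omega> \<delta>)"
proof -
  let ?E = "enlarged \<Omega> \<delta>" and ?X = "Lp0_space p \<Omega> \<delta>"
  have Ol: "\<Omega> \<in> sets lebesgue" and El: "?E \<in> sets lebesgue"
    using \<Omega> \<delta> open_enlarged[of \<Omega> \<delta>] by auto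
  have XV: "?X \<subseteq> Lp_space p ?E" by (auto simp: Lp0_space_def)
  have eq: "Lp_norm p ?E u = Lp_norm p \<Omega> u" if u: "u \<in> ?X" for u
  proof (rule Lp_norm_extend_zero[OF Ol El subset_enlarged p])
    show "AE x in lebesgue_on (?E - \<Omega>). u x = 0"
      using u unfolding enlarged_diff by (simp add: Lp0_space_def)
  qed (use u in \<open>simp add: Lp0_space_def Lp_space_def\<close>)
  have X: "subspace ?X"
  proof (rule subspaceI)
    show "0 \<in> ?X" using subspace_0[OF subspace_Lp_space[OF p, of ?E]] by (simp add: Lp0_space_def)
  next
    fix u v assume "u \<in> ?X" "v \<in> ?X"
    then show "u + v \<in> ?X"
      using subspace_add[OF subspace_Lp_space[OF p, of ?E], of u v]
      by (auto simp: Lp0_space_def elim: eventually_elim2)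
  next
    fix a :: real and u assume "u \<in> ?X"
    then show "a *\<^sub>R u \<in> ?X"
      using subspace_scale[OF subspace_Lp_space[OF p, of ?E], of u a]
      by (auto simp: Lp0_space_def scaleR_fun_def elim: eventually_mono)
  qed
  have "finite_rank_approximable ?X (Lp_norm p \<Omega>) (Lp_norm p \<Omega>) (\<lambda>u. nonlocal_deriv \<nu> u)"
    by (rule finite_rank_approximable_compose[OF nonlocal_deriv_finite_rank_approximable[OF \<nu> \<Omega>(2,3)
      open_enlarged[OF \<Omega>(2) \<delta>] bounded_enlarged[OF \<Omega>(3)] cball_subset_enlarged p], where P="\<lambda>u. u"])
      (use XV eq in auto)
  moreover have "Lp_norm p \<Omega> u < \<infinity>" if "u \<in> ?X" for u
    using that XV eq[OF that] by (auto simp: Lp_space_def)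
  ultimately show ?thesis
    using X infinite_dimensional_Lp0_space[OF \<Omega> \<delta> p X]
    by (intro not_bounded_below_if_finite_rank_approximable[where V="?X"]) auto
qed

section \<open>Operators built from several mean-free kernels\<close>

theorem corollary4p9:
  fixes \<Omega> :: "(real ^ 'd) set" and \<delta> :: real and p :: ennreal
    and \<mu> :: "(real ^ 'd \<Rightarrow> real) ^ 'm" and c :: "real ^ 'm"
  assumes "\<Omega> \<noteq> {}" "open \<Omega>" "bounded \<Omega>" and "\<delta> > 0" and "1 \<le> p"
    and "\<forall>k. integrable lebesgue (\<mu> $ k)"
    and "\<forall>k. ess_support (\<mu> $ k) \<subseteq> cball 0 \<delta>"
    and "\<forall>k. mean_free (\<mu> $ k)"
  shows
    "(\<forall>X. closed_subspace (Lp_norm p (enlarged \<Omega> \<delta>)) (Lp_space p (enlarged \<Omega> \<delta>)) X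
          \<longrightarrow> infinite_dimensional (Lp_norm p (enlarged \<Omega> \<delta>)) X
          \<longrightarrow> \<not> bounded_below_on (Lp_norm p (enlarged \<Omega> \<delta>)) (Lp_norm p (enlarged \<Omega> \<delta>))
                 (op_A \<Omega> \<mu> c) X)
     \<and> (\<forall>X. closed_subspace (Lp_norm p (enlarged \<Omega> \<delta>)) (Lp_space p (enlarged \<Omega> \<delta>)) X
          \<longrightarrow> infinite_dimensional (Lp_norm p (enlarged \<Omega> \<delta>)) X
          \<longrightarrow> \<not> bounded_below_on (Lp_norm p (enlarged \<Omega> \<delta>)) (Lp_vec_norm p (enlarged \<Omega> \<delta>))
                 (op_G \<Omega> \<mu> c) X)
     \<and> (\<forall>X. closed_subspace (Lp_vec_norm p (enlarged \<Omega> \<delta>)) (Lp_vec_space p (enlarged \<Omega> \<delta>)) X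
          \<longrightarrow> infinite_dimensional (Lp_vec_norm p (enlarged \<Omega> \<delta>)) X
          \<longrightarrow> \<not> bounded_below_on (Lp_vec_norm p (enlarged \<Omega> \<delta>)) (Lp_norm p (enlarged \<Omega> \<delta>))
                 (op_D \<Omega> \<mu> c) X)
     \<and> (\<forall>\<nu> :: real ^ 'd \<Rightarrow> real.
          integrable lebesgue \<nu> \<longrightarrow> ess_support \<nu> \<subseteq> cball 0 \<delta> \<longrightarrow> mean_free \<nu> \<longrightarrow>
          \<not> (\<exists>C::real. \<forall>u \<in> Lp0_space p \<Omega> \<delta>.
                Lp_norm p \<Omega> u \<le> ennreal C * Lp_norm p \<Omega> (nonlocal_deriv \<nu> u)))"
proof -
  let ?E = "enlarged \<Omega> \<delta>"
  let ?V = "Lp_space p ?E" and ?N = "Lp_norm p ?E"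
  let ?W = "Lp_vec_space p ?E :: ((real ^ 'd \<Rightarrow> real) ^ 'm) set"
  let ?M = "Lp_vec_norm p ?E :: (real ^ 'd \<Rightarrow> real) ^ 'm \<Rightarrow> ennreal"
  let ?D = "\<lambda>k. ext_nonlocal_deriv \<Omega> (\<mu> $ k)"
  have \<delta>: "0 \<le> \<delta>" using assms(4) by simp
  note \<mu> = assms(6)[rule_format] assms(7)[rule_format] assms(8)[rule_format]
  have meas: "?D k u \<in> borel_measurable (lebesgue_on ?E)" if "u \<in> ?V" for k u
    by (rule ext_nonlocal_deriv_measurable_and_norm(1)[OF \<mu> assms(2,3) \<delta> assms(5) that])
  have approx: "finite_rank_approximable ?V ?N ?N (?D k)" for k
    by (rule ext_nonlocal_deriv_finite_rank_approximable[OF \<mu> assms(2,3) \<delta> assms(5)])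
  \<comment> \<open>The factor of \<open>Lp_norm_sum_le\<close> for all components together; since there is at least one
    component, it also dominates the factor for each component alone.\<close>
  define C where "C = ((\<Sum>k\<in>UNIV. \<bar>c $ k\<bar>) + 1) * (real CARD('m) + 1)"

  have A: "finite_rank_approximable ?V ?N ?N (op_A \<Omega> \<mu> c)"
  proof (rule finite_rank_approximable_sum_bound[where K="UNIV :: 'm set" and T="?D" and C=C])
    fix u assume "u \<in> ?V"
    then show "?N (op_A \<Omega> \<mu> c u) \<le> ennreal C * (\<Sum>k\<in>UNIV. ?N (?D k u))"
      unfolding op_A_def C_def by (intro Lp_norm_sum_le meas assms(5)) auto
  qed (auto simp: approx)

  have G: "finite_rank_approximable ?V ?N ?M (op_G \<Omega> \<mu> c)"
  proof (rule finite_rank_approximable_sum_bound[where K="UNIV :: 'm set" and T="?D" and C=C])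
    fix u assume u: "u \<in> ?V"
    have "?N ((c $ k) *\<^sub>R ?D k u) \<le> ennreal C * ?N (?D k u)" for k
    proof -
      have "\<bar>c $ k\<bar> \<le> (\<Sum>k\<in>UNIV. \<bar>c $ k\<bar>)" by (intro member_le_sum) auto
      moreover have "1 \<le> CARD('m)" by (simp add: Suc_le_eq)
      ultimately have "(\<bar>c $ k\<bar> + 1) * 2 \<le> C"
        unfolding C_def by (intro mult_mono) (auto intro: add_nonneg_nonneg sum_nonneg)
      then have "ennreal ((\<bar>c $ k\<bar> + 1) * 2) * ?N (?D k u) \<le> ennreal C * ?N (?D k u)"
        by (intro mult_right_mono ennreal_leI) auto
      then show ?thesis using Lp_norm_scaleR_le[OF meas[OF u] assms(5)] order_trans by blast
    qed
    then show "?M (op_G \<Omega> \<mu> c u) \<le> ennreal C * (\<Sum>k\<in>UNIV. ?N (?D k u))"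
      unfolding Lp_vec_norm_def op_G_def sum_distrib_left by (intro sum_mono) simp
  qed (auto simp: approx)

  have D: "finite_rank_approximable ?W ?M ?N (op_D \<Omega> \<mu> c)"
  proof (rule finite_rank_approximable_sum_bound[where K="UNIV :: 'm set"
        and T="\<lambda>k u. ?D k (u $ k)" and C=C])
    fix k :: 'm
    have "?N (u $ k) \<le> ?M u" for u
      unfolding Lp_vec_norm_def by (rule member_le_sum) auto
    then show "finite_rank_approximable ?W ?M ?N (\<lambda>u. ?D k (u $ k))"
      by (intro finite_rank_approximable_compose[OF approx, where P="\<lambda>u. u $ k"])
        (auto simp: Lp_vec_space_def)
  next
    fix u assume "u \<in> ?W"
    then have "u $ k \<in> ?V" for k by (simp add: Lp_vec_space_def)
    then show "?N (op_D \<Omega> \<mu> c u) \<le> ennreal C * (\<Sum>k\<in>UNIV. ?N (?D k (u $ k)))"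
      unfolding op_D_def C_def by (intro Lp_norm_sum_le meas assms(5)) auto
  qed auto

  have finV: "?N u < \<infinity>" if "u \<in> ?V" for u using that by (simp add: Lp_space_def)
  have finW: "?M u < \<infinity>" if "u \<in> ?W" for u
    using that by (auto simp: Lp_vec_space_def Lp_space_def Lp_vec_norm_def less_top)

  show ?thesis
  proof (intro conjI allI impI)
    fix X assume "closed_subspace ?N ?V X" "infinite_dimensional ?N X"
    then show "\<not> bounded_below_on ?N ?N (op_A \<Omega> \<mu> c) X"
      by (intro not_bounded_below_if_finite_rank_approximable[OF A _ _ finV])
        (auto simp: closed_subspace_def)
  next
    fix X assume "closed_subspace ?N ?V X" "infinite_dimensional ?N X"
    then show "\<not> bounded_below_on ?N ?M (op_G \<Omega> \<mu> c) X"
      by (intro not_bounded_below_if_finite_rank_approximable[OF G _ _ finV])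
        (auto simp: closed_subspace_def)
  next
    fix X assume "closed_subspace ?M ?W X" "infinite_dimensional ?M X"
    then show "\<not> bounded_below_on ?M ?N (op_D \<Omega> \<mu> c) X"
      by (intro not_bounded_below_if_finite_rank_approximable[OF D _ _ finW])
        (auto simp: closed_subspace_def)
  next
    fix \<nu> :: "real ^ 'd \<Rightarrow> real"
    assume "integrable lebesgue \<nu>" "ess_support \<nu> \<subseteq> cball 0 \<delta>" "mean_free \<nu>"
    from no_poincare_inequality[OF this assms(1-3) \<delta> assms(5)]
    show "\<not> (\<exists>C::real. \<forall>u \<in> Lp0_space p \<Omega> \<delta>. Lp_norm p \<Omega> u \<le> ennreal C * Lp_norm p \<Omega> (nonlocal_deriv \<nu> u))"
      unfolding bounded_below_on_def .
  qed
qed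

end
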